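(* Let $f$ be a transcendental entire function and let $U\subset\mathbb{C}$ be an open set intersecting the Julia set $J(f)$ of $f$. Then for any $R>0$ there exists $m\in\mathbb{N}$ such that $$S(U,f^n)\geq \log M^{n-m}(R,f)$$ for all sufficiently large $n$.
   Context: $f^n$ denotes the $n$-th iterate of $f$. The Julia set $J(f)$ is the set of all points of $\mathbb{C}$ having no neighborhood in which the iterates $(f^n)_{n\in\mathbb{N}}$ form a normal family. For an entire function $g$, the spherical derivative is $g^\#(z)=\frac{|g'(z)|}{1+|g(z)|^2}$, and the normalized spherical area is $S(U,g)=\frac{1}{\pi}\int_U g^\#(z)^2\,dx\,dy$ (where $z=x+iy$). The maximum modulus is $M(r,f)=\max_{|z|=r}|f(z)|$, and $M^n(r,f)$ denotes its iterate with respect to the first variable: $M^1(r,f)=M(r,f)$ and $M^{n+1}(r,f)=M(M^n(r,f),f)$. *)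

theory Defs
  imports "HOL-Complex_Analysis.Complex_Analysis"
begin

definition transcendental_entire :: "(complex \<Rightarrow> complex) \<Rightarrow> bool" where
  "transcendental_entire f \<longleftrightarrow>
     f holomorphic_on UNIV \<and> \<not> (\<exists>p :: complex poly. \<forall>z. f z = poly p z)"

(* Inverse stereographic projection onto the unit sphere of complex * real, which serves as
   the Riemann sphere, (0, 1) being the point at infinity. The Euclidean distance of two
   image points is the chordal distance 2 |z - w| / sqrt ((1 + |z|^2) (1 + |w|^2)). *)
definition to_sphere :: "complex \<Rightarrow> complex \<times> real" where
  "to_sphere z =
     (of_real (2 / (1 + (cmod z)\<^sup>2)) * z, ((cmod z)\<^sup>2 - 1) / ((cmod z)\<^sup>2 + 1))"

(* Normality with respect to the spherical metric. The sphere being closed in complex * real,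
   h automatically takes values in it on D; in particular h may take the value infinity. *)
definition normal_family_on :: "complex set \<Rightarrow> (complex \<Rightarrow> complex) set \<Rightarrow> bool" where
  "normal_family_on D F \<longleftrightarrow>
     (\<forall>g :: nat \<Rightarrow> complex \<Rightarrow> complex. range g \<subseteq> F \<longrightarrow>
        (\<exists>(r :: nat \<Rightarrow> nat) h. strict_mono r \<and>
           (\<forall>K. compact K \<and> K \<subseteq> D \<longrightarrow>
              uniform_limit K (\<lambda>k z. to_sphere (g (r k) z)) h sequentially)))"

definition julia_set :: "(complex \<Rightarrow> complex) \<Rightarrow> complex set" where
  "julia_set f =
     {z. \<not> (\<exists>N. open N \<and> z \<in> N \<and> normal_family_on N (range (\<lambda>n. f ^^ n)))}"

definition spherical_deriv :: "(complex \<Rightarrow> complex) \<Rightarrow> complex \<Rightarrow> real" where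
  "spherical_deriv g z = cmod (deriv g z) / (1 + (cmod (g z))\<^sup>2)"

(* The value may be infinite, for instance if U is unbounded. *)
definition spherical_area :: "complex set \<Rightarrow> (complex \<Rightarrow> complex) \<Rightarrow> ennreal" where
  "spherical_area U g =
     ennreal (1 / pi) * (\<integral>\<^sup>+z\<in>U. ennreal ((spherical_deriv g z)\<^sup>2) \<partial>lborel)"

(* For continuous f and r \<ge> 0 the supremum is attained. *)
definition max_modulus :: "real \<Rightarrow> (complex \<Rightarrow> complex) \<Rightarrow> real" where
  "max_modulus r f = (SUP z\<in>sphere 0 r. cmod (f z))"

definition max_modulus_iter :: "nat \<Rightarrow> real \<Rightarrow> (complex \<Rightarrow> complex) \<Rightarrow> real" where
  "max_modulus_iter n r f = ((\<lambda>s. max_modulus s f) ^^ n) r"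

end

theory Submission
  imports Defs
begin

text \<open>
The proof compares the spherical area of an iterate on a fixed annulus with its maximum modulus.
Let \<open>g\<close> be entire and \<open>u = log (1 + |g|\<^sup>2) / 2\<close>. The Laplacian of \<open>u\<close> is twice the square of the
spherical derivative of \<open>g\<close>. So the spherical area of an annulus is, up to a constant factor, the
increment of the slope of the circular means of \<open>u\<close>, regarded as functions of the logarithm of the
radius (the Ahlfors--Shimizu identity). These means are convex and increasing in that variable. Up to an
additive constant the mean on a circle is at most the logarithm of the maximum modulus, and on a
somewhat larger circle it is at least a constant times that logarithm, by the sub-mean-value property
of \<open>u\<close>. For \<open>P < Q\<close> this gives \<open>S \<ge> c log M(Q,g) - 2 log M(P,g) - log 2\<close> for the area of an annulus
slightly larger than \<open>P < |z| < Q\<close>, where \<open>c > 0\<close> depends only on \<open>Q/P\<close>. This is \<open>spherical_area_annulus_ge\<close>.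

It is applied to \<open>g = f\<^sup>n\<close> with \<open>P\<close> fixed and \<open>Q = K M(P,f)\<close>. Clearly
\<open>M(P,f\<^sup>n) \<le> x\<close> for \<open>x = M\<^sup>n(P,f)\<close>. In the other direction, Schottky's theorem shows that the image
of a disc under an entire function contains a circle whose radius is comparable with the maximum
modulus on the disc of half the radius. By induction, and because a transcendental function grows
fast under dilations, \<open>M(K r, f\<^sup>n) \<ge> M\<^sup>n(r,f)\<close> for some \<open>K\<close>, all large \<open>r\<close> and all \<open>n\<close>
(\<open>max_modulus_iter_le_funpow\<close>). Hence \<open>M(Q,f\<^sup>n) \<ge> M(x,f)\<close>, and since \<open>log M(x,f) / log x\<close> tends to
infinity with \<open>x\<close>, the area of \<open>f\<^sup>n\<close> on the annulus exceeds \<open>log x\<close> for all large \<open>n\<close>. It matters that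
\<open>K\<close> and \<open>c\<close> do not depend on \<open>n\<close>: when \<open>log M(r,f) / log r\<close> grows slowly, a loss of a constant factor in
each iteration could not be absorbed by the shift \<open>m\<close>.

It remains to get from \<open>U\<close> to such an annulus. If no image \<open>f\<^sup>m(U)\<close> contained one of two given
disjoint closed annuli, then every iterate would omit on \<open>U\<close> two values that are bounded and a fixed distance
apart, and Montel's argument would make the iterates normal near a point of the Julia set
(\<open>julia_set_blow_up\<close>). So some \<open>f\<^sup>m(U)\<close> contains one of the two annuli, and the area of \<open>f\<^sup>n\<close> on it is at
most the area of \<open>f\<^bsup>n+m\<^esup>\<close> on \<open>U\<close>, because the area of an image is counted with multiplicity. Two annuli
are used, rather than one, because this avoids any discussion of exceptional values.
\<close>

section \<open>The area inequality for holomorphic maps and logarithmic polar coordinates\<close>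

text \<open>
The change of variables formula concerns real coordinate space, and Fubini's theorem concerns products.
With this lemma and the next one, both carry over to the complex plane.
\<close>

lemma lborel_complex_eq_distr_vec:
  "(lborel :: complex measure) = distr lborel borel (\<lambda>v::real^2. Complex (v$1) (v$2))"
proof (rule lborel_eqI)
  fix l u :: complex assume "\<And>b. b \<in> Basis \<Longrightarrow> l \<bullet> b \<le> u \<bullet> b"
  from this[of 1] this[of \<i>] have le: "Re l \<le> Re u" "Im l \<le> Im u"
    by (simp_all add: Basis_complex_def)
  have vec_le: "(vector [Re l, Im l] :: real^2) $ x \<le> vector [Re u, Im u] $ x" for x
    using le exhaust_2[of x] by auto
  let ?T = "\<lambda>v::real^2. Complex (v$1) (v$2)"
  have cont: "continuous_on UNIV ?T"
    unfolding Complex_eq by (intro continuous_intros)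
  have [measurable]: "?T \<in> borel_measurable borel"
    by (rule borel_measurable_continuous_onI[OF cont])
  have pre: "?T -` box l u = box (vector [Re l, Im l]) (vector [Re u, Im u])"
    by (auto simp: box_def Basis_complex_def Basis_vec_def inner_axis forall_2 cart_eq_inner_axis[symmetric])
  have "emeasure (distr lborel borel ?T) (box l u) = emeasure lborel (?T -` box l u)"
    by (subst emeasure_distr) auto
  also have "\<dots> = ennreal (\<Prod>b\<in>Basis. (vector [Re u, Im u] - vector [Re l, Im l] :: real^2) \<bullet> b)"
    unfolding pre using vec_le
    by (subst emeasure_lborel_box) (auto simp: Basis_vec_def inner_axis)
  also have "(\<Prod>b\<in>Basis. (vector [Re u, Im u] - vector [Re l, Im l] :: real^2) \<bullet> b)
      = (Re u - Re l) * (Im u - Im l)"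
  proof -
    have B: "(Basis :: (real^2) set) = {axis 1 1, axis 2 1}"
      by (auto simp: Basis_vec_def UNIV_2)
    have ne: "axis 1 1 \<noteq> (axis 2 1 :: real^2)" by (simp add: axis_eq_axis)
    show ?thesis unfolding B using ne by (subst prod.insert) (auto simp: inner_axis)
  qed
  also have "\<dots> = (\<Prod>b\<in>Basis. (u - l) \<bullet> b)"
    by (simp add: Basis_complex_def)
  finally show "emeasure (distr lborel borel ?T) (box l u) = ennreal (\<Prod>b\<in>Basis. (u - l) \<bullet> b)" .
qed auto

lemma lborel_complex_eq_distr_prod:
  "(lborel :: complex measure) = distr lborel borel (\<lambda>(x, y). Complex x y)"
proof (rule lborel_eqI)
  fix l u :: complex assume "\<And>b. b \<in> Basis \<Longrightarrow> l \<bullet> b \<le> u \<bullet> b"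
  from this[of 1] this[of \<i>] have le: "Re l \<le> Re u" "Im l \<le> Im u"
    by (simp_all add: Basis_complex_def)
  let ?T = "\<lambda>(x, y). Complex x y"
  have cont: "continuous_on UNIV ?T"
    unfolding Complex_eq split_beta by (intro continuous_intros)
  have [measurable]: "?T \<in> borel_measurable borel"
    by (rule borel_measurable_continuous_onI[OF cont])
  have pre: "?T -` box l u = box (Re l, Im l) (Re u, Im u)"
    by (auto simp: box_def Basis_complex_def Basis_prod_def)
  have "emeasure (distr lborel borel ?T) (box l u) = emeasure lborel (?T -` box l u)"
    by (subst emeasure_distr) auto
  also have "\<dots> = ennreal (\<Prod>b\<in>Basis. (u - l) \<bullet> b)"
    unfolding pre using le
    by (subst emeasure_lborel_box)
       (auto simp: Basis_complex_def Basis_prod_def mult.commute)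
  finally show "emeasure (distr lborel borel ?T) (box l u) = ennreal (\<Prod>b\<in>Basis. (u - l) \<bullet> b)" .
qed auto

lemma abs_det_complex_mult:
  fixes c :: complex
  defines "L \<equiv> (\<lambda>v::real^2. vector [Re (c * Complex (v$1) (v$2)), Im (c * Complex (v$1) (v$2))] :: real^2)"
  shows "\<bar>det (matrix L)\<bar> = (cmod c)\<^sup>2"
  by (simp add: det_2 matrix_def L_def axis_def cmod_power2 power2_eq_square[symmetric])

text \<open>
A point of \<open>W\<close> is counted once on the left and once for each preimage on the right. In real
coordinates the Jacobian determinant of a holomorphic map is \<open>|\<phi>'|\<^sup>2\<close>, and for maps with
several preimages the change of variables formula becomes an inequality of this kind.
\<close>

lemma nn_integral_holomorphic_image_le:
  fixes h :: "complex \<Rightarrow> real"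
  assumes V: "open V" and hol: "\<phi> holomorphic_on V" and W: "W \<in> sets borel" "W \<subseteq> \<phi> ` V"
    and h [measurable]: "h \<in> borel_measurable borel" and h0: "\<And>z. 0 \<le> h z"
  shows "(\<integral>\<^sup>+z\<in>W. ennreal (h z) \<partial>lborel)
         \<le> (\<integral>\<^sup>+z\<in>V. ennreal (h (\<phi> z) * (cmod (deriv \<phi> z))\<^sup>2) \<partial>lborel)"
proof (cases "(\<integral>\<^sup>+z\<in>V. ennreal (h (\<phi> z) * (cmod (deriv \<phi> z))\<^sup>2) \<partial>lborel) < \<infinity>")
  case False
  then show ?thesis by (metis infinity_ennreal_def not_less_iff_gr_or_eq top.not_eq_extremum top_greatest)
next
  case fin: True
  note W(1)[measurable]
  define T where "T = (\<lambda>v::real^2. Complex (v$1) (v$2))"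
  define T' where "T' = (\<lambda>z. vector [Re z, Im z] :: real^2)"
  have TT' [simp]: "T (T' z) = z" "T' (T v) = v" for z v
    by (auto simp: T_def T'_def complex_eq_iff vec_eq_iff forall_2)
  have lbc: "(lborel :: complex measure) = distr lborel borel T"
    unfolding T_def by (rule lborel_complex_eq_distr_vec)
  have blT: "bounded_linear T"
    by (rule linear_conv_bounded_linear[THEN iffD1], rule linearI)
       (auto simp: T_def complex_eq_iff)
  have blT': "bounded_linear T'"
    by (rule linear_conv_bounded_linear[THEN iffD1], rule linearI)
       (auto simp: T'_def vec_eq_iff forall_2)
  have [measurable]: "T \<in> borel_measurable borel"
    by (intro borel_measurable_continuous_onI linear_continuous_on blT)
  define f where "f = (\<lambda>z. h z * indicator W z)"
  have f0: "f z \<ge> 0" for z by (auto simp: f_def h0)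
  have [measurable]: "f \<in> borel_measurable borel" unfolding f_def by measurable
  have [measurable]: "V \<in> sets borel" using V by simp
  define F where "F = (\<lambda>z. indicator V z * (f (\<phi> z) * (cmod (deriv \<phi> z))\<^sup>2))"
  have F0: "F z \<ge> 0" for z by (auto simp: F_def f0)
  have Fm [measurable]: "F \<in> borel_measurable borel"
  proof -
    have 1: "(\<lambda>z. if z \<in> V then \<phi> z else 0) \<in> borel_measurable borel"
      by (rule borel_measurable_continuous_on_if)
         (use hol in \<open>auto intro: holomorphic_on_imp_continuous_on\<close>)
    have 2: "(\<lambda>z. if z \<in> V then deriv \<phi> z else 0) \<in> borel_measurable borel"
      by (rule borel_measurable_continuous_on_if)
         (use holomorphic_deriv[OF hol V] in \<open>auto intro: holomorphic_on_imp_continuous_on\<close>)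
    have "F = (\<lambda>z. indicator V z * (f (if z \<in> V then \<phi> z else 0) * (cmod (if z \<in> V then deriv \<phi> z else 0))\<^sup>2))"
      by (auto simp: F_def)
    also have "\<dots> \<in> borel_measurable borel" using 1 2 by measurable
    finally show ?thesis .
  qed
  have Fle: "(\<integral>\<^sup>+z. ennreal (F z) \<partial>lborel) \<le> (\<integral>\<^sup>+z\<in>V. ennreal (h (\<phi> z) * (cmod (deriv \<phi> z))\<^sup>2) \<partial>lborel)"
    by (intro nn_integral_mono) (auto simp: F_def f_def indicator_def h0)
  define S where "S = T -` V"
  define g where "g = T' \<circ> \<phi> \<circ> T"
  define g' where "g' = (\<lambda>x v. T' (deriv \<phi> (T x) * T v))"
  have det: "\<bar>det (matrix (g' x))\<bar> = (cmod (deriv \<phi> (T x)))\<^sup>2" for x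
    unfolding g'_def T'_def T_def by (rule abs_det_complex_mult)
  have FT: "F (T x) = (if x \<in> S then \<bar>det (matrix (g' x))\<bar> * f (T (g x)) else 0)" for x
    by (auto simp: F_def S_def det g_def)
  have nnF: "(\<integral>\<^sup>+x. ennreal (F (T x)) \<partial>lborel) = (\<integral>\<^sup>+z. ennreal (F z) \<partial>lborel)"
    by (subst lbc, subst nn_integral_distr) auto
  have intF: "(\<lambda>x. F (T x)) integrable_on UNIV"
    by (rule nn_integral_integrable_on) (use F0 nnF Fle fin in auto)
  have int1: "(\<lambda>x. \<bar>det (matrix (g' x))\<bar> * f (T (g x))) integrable_on S"
    using intF unfolding FT by (simp add: integrable_restrict_UNIV)
  have der: "(g has_derivative g' x) (at x within S)" if "x \<in> S" for x
  proof -
    have "(\<phi> has_field_derivative deriv \<phi> (T x)) (at (T x))"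
      using that hol V by (auto simp: S_def intro: holomorphic_derivI)
    then have d: "(\<phi> has_derivative (\<lambda>w. deriv \<phi> (T x) * w)) (at (T x))"
      by (simp add: has_field_derivative_def)
    have dT: "(T has_derivative T) (at x)" using blT by (rule bounded_linear_imp_has_derivative)
    have dT': "(T' has_derivative T') (at y)" for y using blT' by (rule bounded_linear_imp_has_derivative)
    have "(g has_derivative g' x) (at x)"
      using diff_chain_at[OF diff_chain_at[OF dT d] dT'] 
      unfolding g_def g'_def by (simp add: o_def)
    then show ?thesis by (rule has_derivative_at_withinI)
  qed
  have key: "(\<lambda>v. f (T v)) integrable_on (g ` S)"
     "integral (g ` S) (\<lambda>v. f (T v)) \<le> integral S (\<lambda>x. \<bar>det (matrix (g' x))\<bar> * f (T (g x)))"
    using integral_on_image_ubound_nonneg[of S "\<lambda>v. f (T v)" g g', OF f0 der int1] by auto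
  have sub: "T v \<in> W \<Longrightarrow> v \<in> g ` S" for v
  proof -
    assume "T v \<in> W"
    then obtain z where "z \<in> V" "T v = \<phi> z" using W by auto
    then show "v \<in> g ` S" unfolding g_def S_def
      by (intro image_eqI[of _ _ "T' z"]) (auto, metis TT'(2))
  qed
  have "(\<integral>\<^sup>+z\<in>W. ennreal (h z) \<partial>lborel) = (\<integral>\<^sup>+z. ennreal (f z) \<partial>lborel)"
    by (intro nn_integral_cong) (auto simp: f_def indicator_def)
  also have "\<dots> = (\<integral>\<^sup>+v. ennreal (f (T v)) \<partial>lborel)"
    by (subst lbc, subst nn_integral_distr) auto
  also have "\<dots> = (\<integral>\<^sup>+v. ennreal (f (T v)) * indicator (g ` S) v \<partial>lborel)"
    using sub by (intro nn_integral_cong) (auto simp: f_def indicator_def)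
  also have "\<dots> = ennreal (integral (g ` S) (\<lambda>v. f (T v)))"
    using key(1) by (intro nn_integral_has_integral_lebesgue') (auto simp: f0)
  also have "\<dots> \<le> ennreal (integral S (\<lambda>x. \<bar>det (matrix (g' x))\<bar> * f (T (g x))))"
    using key(2) by (rule ennreal_leI)
  also have "\<dots> = ennreal (integral UNIV (\<lambda>x. F (T x)))"
    unfolding FT by (simp add: integral_restrict_UNIV)
  also have "\<dots> = (\<integral>\<^sup>+x. ennreal (F (T x)) \<partial>lborel)"
    using nn_integral_has_integral_lebesgue'[of UNIV "\<lambda>x. F (T x)", OF F0 integrable_integral[OF intF]]
    by simp
  also have "\<dots> \<le> (\<integral>\<^sup>+z\<in>V. ennreal (h (\<phi> z) * (cmod (deriv \<phi> z))\<^sup>2) \<partial>lborel)"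
    using nnF Fle by simp
  finally show ?thesis .
qed

lemma nn_integral_complex_rectangle:
  fixes k :: "complex \<Rightarrow> real"
  assumes k: "continuous_on UNIV k" and k0: "\<And>z. 0 \<le> k z"
  shows "(\<integral>\<^sup>+z\<in>{z. a < Re z \<and> Re z < b \<and> c < Im z \<and> Im z < d}. ennreal (k z) \<partial>lborel)
         = ennreal (integral {a..b} (\<lambda>s. integral {c..d} (\<lambda>t. k (Complex s t))))"
proof -
  have cT: "continuous_on UNIV (\<lambda>(x, y). Complex x y)"
    unfolding Complex_eq split_beta by (intro continuous_intros)
  have [measurable]: "(\<lambda>(x, y). Complex x y) \<in> borel_measurable borel"
    by (rule borel_measurable_continuous_onI[OF cT])
  have [measurable]: "k \<in> borel_measurable borel"
    by (rule borel_measurable_continuous_onI[OF k])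
  define k' where "k' = (\<lambda>(x, y). k (Complex x y))"
  have ck': "continuous_on S k'" for S
    using continuous_on_compose2[OF k cT] unfolding k'_def
    by (auto simp: split_beta intro: continuous_on_subset)
  have "open {z. a < Re z \<and> Re z < b \<and> c < Im z \<and> Im z < d}"
    by (intro open_Collect_conj open_Collect_less continuous_intros)
  then have [measurable]: "{z. a < Re z \<and> Re z < b \<and> c < Im z \<and> Im z < d} \<in> sets borel" by simp
  have "(\<integral>\<^sup>+z\<in>{z. a < Re z \<and> Re z < b \<and> c < Im z \<and> Im z < d}. ennreal (k z) \<partial>lborel)
        = (\<integral>\<^sup>+p. ennreal (k' p) * indicator (box (a, c) (b, d)) p \<partial>lborel)"
    by (subst lborel_complex_eq_distr_prod, subst nn_integral_distr)
       (auto intro!: nn_integral_cong simp: k'_def box_def Basis_prod_def split: split_indicator)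
  also have "\<dots> = ennreal (integral (box (a, c) (b, d)) k')"
  proof (rule nn_integral_has_integral_lebesgue')
    have "k' integrable_on box (a, c) (b, d)"
      by (simp add: integrable_on_open_interval integrable_continuous ck')
    then show "(k' has_integral integral (box (a, c) (b, d)) k') (box (a, c) (b, d))"
      by (rule integrable_integral)
  qed (auto simp: k'_def k0)
  also have "integral (box (a, c) (b, d)) k' = integral {a..b} (\<lambda>s. integral {c..d} (\<lambda>t. k (Complex s t)))"
    using integral_prod_continuous[of a c b d k'] ck'
    by (simp add: integral_open_interval k'_def)
  finally show ?thesis .
qed

text \<open>
Integration in logarithmic polar coordinates about \<open>a\<close>. The inverse of \<open>z \<mapsto> a + l e\<^sup>z\<close>, a
branch of the logarithm, maps the annulus slit along a ray onto the open rectangle; applying the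
area inequality to this inverse gives the direction that is used below. The factor \<open>l\<close> moves the
slit and the unit of length.
\<close>

lemma nn_integral_log_polar_le:
  fixes h :: "complex \<Rightarrow> real" and l :: complex
  assumes l: "l \<noteq> 0" and h [measurable]: "h \<in> borel_measurable borel" and h0: "\<And>z. 0 \<le> h z"
  shows "(\<integral>\<^sup>+z\<in>{z. \<alpha> < Re z \<and> Re z < \<beta> \<and> - pi < Im z \<and> Im z < pi}.
            ennreal (h (a + l * exp z) * (cmod (l * exp z))\<^sup>2) \<partial>lborel)
         \<le> (\<integral>\<^sup>+z\<in>{z. cmod l * exp \<alpha> < cmod (z - a) \<and> cmod (z - a) < cmod l * exp \<beta>}. ennreal (h z) \<partial>lborel)"
proof -
  \<comment> \<open>Here \<open>H\<close> is such that \<open>H \<circ> \<phi>\<close> times the Jacobian of \<open>\<phi>\<close> is \<open>h\<close> on \<open>V\<close>.\<close>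
  define W where "W = {z. \<alpha> < Re z \<and> Re z < \<beta> \<and> - pi < Im z \<and> Im z < pi}"
  define N where "N = {z. cmod l * exp \<alpha> < cmod (z - a) \<and> cmod (z - a) < cmod l * exp \<beta>}"
  define V where "V = N \<inter> (\<lambda>z. (z - a) / l) -` (- \<real>\<^sub>\<le>\<^sub>0)"
  define \<phi> where "\<phi> = (\<lambda>z. Ln ((z - a) / l))"
  define H where "H = (\<lambda>z. h (a + l * exp z) * (cmod (l * exp z))\<^sup>2)"
  have oN: "open N" unfolding N_def
    by (intro open_Collect_conj open_Collect_less continuous_intros)
  have "open ((\<lambda>z. (z - a) / l) -` (- \<real>\<^sub>\<le>\<^sub>0))"
    by (intro open_vimage) (use l in \<open>auto intro!: continuous_intros\<close>)
  with oN have oV: "open V" unfolding V_def by (rule open_Int)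
  have hol: "\<phi> holomorphic_on V"
    unfolding \<phi>_def V_def using l by (intro holomorphic_intros) auto
  have "open W" unfolding W_def
    by (intro open_Collect_conj open_Collect_less continuous_intros)
  then have W: "W \<in> sets borel" by simp
  have sub: "W \<subseteq> \<phi> ` V"
  proof
    fix z assume z: "z \<in> W"
    have "exp z \<notin> \<real>\<^sub>\<le>\<^sub>0"
    proof
      assume "exp z \<in> \<real>\<^sub>\<le>\<^sub>0"
      moreover have "Ln (exp z) = z" using z by (intro Ln_exp) (auto simp: W_def)
      moreover have "Re (exp z) \<noteq> 0 \<or> Im (exp z) \<noteq> 0"
        using exp_not_eq_zero[of z] by (simp only: complex_eq_iff zero_complex.sel) simp
      ultimately have "Im z = pi"
        using Im_Ln_eq_pi[of "exp z"] by (auto simp: complex_nonpos_Reals_iff complex_eq_iff less_le)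
      with z show False by (simp add: W_def)
    qed
    with z l have "a + l * exp z \<in> V"
      by (auto simp: V_def N_def W_def norm_mult)
    moreover have "\<phi> (a + l * exp z) = z" using z l unfolding \<phi>_def
      by simp (intro Ln_exp, auto simp: W_def)
    ultimately show "z \<in> \<phi> ` V" by force
  qed
  have Hm: "H \<in> borel_measurable borel"
  proof -
    have [measurable]: "exp \<in> borel_measurable (borel :: complex measure)"
      by (intro borel_measurable_continuous_onI continuous_intros)
    show ?thesis unfolding H_def by measurable
  qed
  have eq: "H (\<phi> z) * (cmod (deriv \<phi> z))\<^sup>2 = h z" if "z \<in> V" for z
  proof -
    have nz: "(z - a) / l \<notin> \<real>\<^sub>\<le>\<^sub>0" using that by (simp add: V_def)
    then have za: "z - a \<noteq> 0" by auto
    have "(\<phi> has_field_derivative 1 / (z - a)) (at z)"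
      unfolding \<phi>_def using nz za l by (auto intro!: derivative_eq_intros simp: field_simps)
    then have d: "deriv \<phi> z = 1 / (z - a)" by (rule DERIV_imp_deriv)
    have "l * exp (\<phi> z) = z - a" using za l by (simp add: \<phi>_def exp_Ln)
    then show ?thesis using za by (simp add: H_def d norm_divide power_divide)
  qed
  have "(\<integral>\<^sup>+z\<in>W. ennreal (H z) \<partial>lborel)
      \<le> (\<integral>\<^sup>+z\<in>V. ennreal (H (\<phi> z) * (cmod (deriv \<phi> z))\<^sup>2) \<partial>lborel)"
    by (rule nn_integral_holomorphic_image_le[OF oV hol W sub Hm]) (simp add: H_def h0)
  also have "\<dots> \<le> (\<integral>\<^sup>+z\<in>N. ennreal (h z) \<partial>lborel)"
    by (intro nn_integral_mono) (auto simp: eq V_def split: split_indicator)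
  finally show ?thesis unfolding W_def N_def H_def .
qed

section \<open>Convexity of circular means\<close>

text \<open>
The potential of the spherical area form: \<open>exp (- log_chordal g z)\<close> is half the chordal distance of \<open>g z\<close>
from infinity.
\<close>

definition log_chordal :: "(complex \<Rightarrow> complex) \<Rightarrow> complex \<Rightarrow> real" where
  "log_chordal g z = ln (1 + (cmod (g z))\<^sup>2) / 2"

text \<open>
With \<open>u\<close> the potential above and \<open>z = s + i t\<close>, this is \<open>u\<^sub>s - i u\<^sub>t\<close>.
\<close>

definition log_chordal_grad :: "(complex \<Rightarrow> complex) \<Rightarrow> complex \<Rightarrow> complex" where
  "log_chordal_grad g z = deriv g z * cnj (g z) / of_real (1 + (cmod (g z))\<^sup>2)"

definition vertical_integral :: "(complex \<Rightarrow> real) \<Rightarrow> real \<Rightarrow> real" where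
  "vertical_integral k s = integral {- pi..pi} (\<lambda>t. k (Complex s t))"

lemma one_plus_sq_pos: "0 < 1 + (cmod z)\<^sup>2"
  by (simp add: add_pos_nonneg)

lemma continuous_log_chordal:
  assumes "g holomorphic_on UNIV"
  shows "continuous_on UNIV (log_chordal g)"
proof -
  have "continuous_on UNIV g" using assms by (rule holomorphic_on_imp_continuous_on)
  then show ?thesis unfolding log_chordal_def using one_plus_sq_pos
    by (intro continuous_intros) (auto simp: less_imp_neq[THEN not_sym] order_less_imp_not_eq2)
qed

lemma continuous_spherical_deriv:
  assumes "g holomorphic_on UNIV"
  shows "continuous_on UNIV (spherical_deriv g)"
proof -
  have "continuous_on UNIV g" "continuous_on UNIV (deriv g)"
    using assms by (auto intro: holomorphic_on_imp_continuous_on holomorphic_deriv)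
  then show ?thesis unfolding spherical_deriv_def using one_plus_sq_pos
    by (intro continuous_intros) (auto simp: order_less_imp_not_eq2)
qed

lemma continuous_log_chordal_grad:
  assumes "g holomorphic_on UNIV"
  shows "continuous_on UNIV (log_chordal_grad g)"
proof -
  have "continuous_on UNIV g" "continuous_on UNIV (deriv g)"
    using assms by (auto intro: holomorphic_on_imp_continuous_on holomorphic_deriv)
  moreover have "complex_of_real (1 + (cmod w)\<^sup>2) \<noteq> 0" for w
    unfolding of_real_eq_0_iff using one_plus_sq_pos[of w] by simp
  ultimately show ?thesis unfolding log_chordal_grad_def
    by (intro continuous_intros) auto
qed

lemma continuous_on_vertical:
  fixes k :: "complex \<Rightarrow> 'a::topological_space"
  assumes "continuous_on UNIV k"
  shows "continuous_on S (\<lambda>t. k (Complex s t))"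
  by (rule continuous_on_compose2[OF assms]) (auto simp: Complex_eq intro!: continuous_intros)

lemma integrable_vertical:
  fixes k :: "complex \<Rightarrow> real"
  assumes "continuous_on UNIV k"
  shows "(\<lambda>t. k (Complex s t)) integrable_on {a..b}"
  by (intro integrable_continuous_interval continuous_on_vertical assms)

lemma vertical_integral_upper:
  assumes "continuous_on UNIV k" "\<And>t. - pi \<le> t \<Longrightarrow> t \<le> pi \<Longrightarrow> k (Complex s t) \<le> c"
  shows "vertical_integral k s \<le> 2 * pi * c"
proof -
  have "vertical_integral k s \<le> integral {- pi..pi} (\<lambda>_. c)"
    unfolding vertical_integral_def using assms
    by (intro integral_le integrable_vertical) auto
  then show ?thesis by simp
qed

lemma vertical_integral_lower:
  assumes "continuous_on UNIV k" "\<And>t. - pi \<le> t \<Longrightarrow> t \<le> pi \<Longrightarrow> c \<le> k (Complex s t)"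
  shows "2 * pi * c \<le> vertical_integral k s"
proof -
  have "integral {- pi..pi} (\<lambda>_. c) \<le> vertical_integral k s"
    unfolding vertical_integral_def using assms
    by (intro integral_le integrable_vertical) auto
  then show ?thesis by simp
qed

lemma vertical_integral_has_derivative:
  fixes k k' :: "complex \<Rightarrow> real"
  assumes k: "continuous_on UNIV k" and k': "continuous_on UNIV k'"
    and d: "\<And>s t. ((\<lambda>s. k (Complex s t)) has_real_derivative k' (Complex s t)) (at s)"
  shows "(vertical_integral k has_real_derivative vertical_integral k' s) (at s)"
proof -
  have c: "continuous_on (UNIV \<times> cbox (- pi) pi) (\<lambda>(s, t). k' (Complex s t))"
    unfolding split_beta
    by (rule continuous_on_compose2[OF k']) (auto simp: Complex_eq intro!: continuous_intros)
  have "((\<lambda>s. integral (cbox (- pi) pi) (\<lambda>t. k (Complex s t))) has_field_derivative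
         integral (cbox (- pi) pi) (\<lambda>t. k' (Complex s t))) (at s within UNIV)"
  proof (rule leibniz_rule_field_derivative)
    show "((\<lambda>s. k (Complex s t)) has_real_derivative k' (Complex x t)) (at x within UNIV)" for x t
      using d[of t x] by simp
    show "(\<lambda>t. k (Complex x t)) integrable_on cbox (- pi) pi" for x
      using integrable_vertical[OF k] by simp
  qed (use c in auto)
  then show ?thesis unfolding vertical_integral_def[abs_def] by simp
qed

lemma Re_Im_along_curve:
  assumes "g holomorphic_on UNIV" "(\<gamma> has_vector_derivative d) (at x)"
  shows "((\<lambda>x. Re (g (\<gamma> x))) has_real_derivative Re (d * deriv g (\<gamma> x))) (at x)"
    "((\<lambda>x. Im (g (\<gamma> x))) has_real_derivative Im (d * deriv g (\<gamma> x))) (at x)"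
proof -
  have "(g has_field_derivative deriv g (\<gamma> x)) (at (\<gamma> x))"
    using assms(1) by (auto intro: holomorphic_derivI)
  from field_vector_diff_chain_at[OF assms(2) this]
  have v: "((\<lambda>x. g (\<gamma> x)) has_vector_derivative d * deriv g (\<gamma> x)) (at x)" by (simp add: o_def)
  show "((\<lambda>x. Re (g (\<gamma> x))) has_real_derivative Re (d * deriv g (\<gamma> x))) (at x)"
    using bounded_linear.has_vector_derivative[OF bounded_linear_Re v]
    by (simp add: has_real_derivative_iff_has_vector_derivative)
  show "((\<lambda>x. Im (g (\<gamma> x))) has_real_derivative Im (d * deriv g (\<gamma> x))) (at x)"
    using bounded_linear.has_vector_derivative[OF bounded_linear_Im v]
    by (simp add: has_real_derivative_iff_has_vector_derivative)
qed

lemma horizontal_line_deriv: "((\<lambda>s. Complex s t) has_vector_derivative 1) (at s)"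
  unfolding Complex_eq by (auto intro!: derivative_eq_intros)

lemma vertical_line_deriv: "((\<lambda>t. Complex s t) has_vector_derivative \<i>) (at t)"
  unfolding Complex_eq by (auto intro!: derivative_eq_intros)

lemma Re_Im_log_chordal_grad:
  "Re (log_chordal_grad g z) =
     (Re (deriv g z) * Re (g z) + Im (deriv g z) * Im (g z)) / (1 + ((Re (g z))\<^sup>2 + (Im (g z))\<^sup>2))"
  "Im (log_chordal_grad g z) =
     (Im (deriv g z) * Re (g z) - Re (deriv g z) * Im (g z)) / (1 + ((Re (g z))\<^sup>2 + (Im (g z))\<^sup>2))"
  unfolding log_chordal_grad_def cmod_power2
  by (simp_all add: Re_divide_of_real Im_divide_of_real del: of_real_add)

lemma half_ln_one_plus_sq_deriv:
  fixes a b :: "real \<Rightarrow> real"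
  assumes "(a has_real_derivative a') (at x)" "(b has_real_derivative b') (at x)"
  shows "((\<lambda>x. ln (1 + ((a x)\<^sup>2 + (b x)\<^sup>2)) / 2) has_real_derivative
           (a' * a x + b' * b x) / (1 + ((a x)\<^sup>2 + (b x)\<^sup>2))) (at x)"
proof -
  have p: "0 < 1 + ((a x)\<^sup>2 + (b x)\<^sup>2)" by (simp add: add_pos_nonneg)
  show ?thesis
    by (rule derivative_eq_intros assms refl p | simp)+ (use p in \<open>simp add: field_simps\<close>)
qed

lemma log_chordal_horizontal_deriv:
  assumes g: "g holomorphic_on UNIV"
  shows "((\<lambda>s. log_chordal g (Complex s t)) has_real_derivative
           Re (log_chordal_grad g (Complex s t))) (at s)"
  using half_ln_one_plus_sq_deriv[OF Re_Im_along_curve[OF g horizontal_line_deriv]]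
  unfolding log_chordal_def Re_Im_log_chordal_grad cmod_power2 by simp

text \<open>
With \<open>u\<close> and \<open>t\<close> as before, this is \<open>- u\<^sub>t\<^sub>t\<close>.
\<close>

definition neg_vertical_deriv2 :: "(complex \<Rightarrow> complex) \<Rightarrow> complex \<Rightarrow> real" where
  "neg_vertical_deriv2 g z =
     (Re (deriv (deriv g) z * cnj (g z)) - (cmod (deriv g z))\<^sup>2) / (1 + (cmod (g z))\<^sup>2)
     + 2 * (Im (deriv g z * cnj (g z)))\<^sup>2 / (1 + (cmod (g z))\<^sup>2)\<^sup>2"

lemma continuous_neg_vertical_deriv2:
  assumes "g holomorphic_on UNIV"
  shows "continuous_on UNIV (neg_vertical_deriv2 g)"
proof -
  have "continuous_on UNIV g" "continuous_on UNIV (deriv g)" "continuous_on UNIV (deriv (deriv g))"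
    using assms by (auto intro!: holomorphic_on_imp_continuous_on holomorphic_deriv)
  then show ?thesis unfolding neg_vertical_deriv2_def using one_plus_sq_pos
    by (intro continuous_intros) (auto simp: order_less_imp_not_eq2)
qed

text \<open>
Here \<open>A + i B\<close>, \<open>C + i D\<close> and \<open>E + i F\<close> are the values of \<open>g\<close>, \<open>g'\<close> and \<open>g''\<close>; the left-hand sides are
what the quotient rule yields for the two components of the gradient.
\<close>

lemma chordal_gradient_algebra:
  fixes A B C D E F :: real
  defines "H \<equiv> 1 + (A\<^sup>2 + B\<^sup>2)"
  shows "((E * A + C * C + (F * B + D * D)) * H - (C * A + D * B) * (2 * A * C + 2 * B * D)) / (H * H)
     = (2 * (C\<^sup>2 + D\<^sup>2)) / H\<^sup>2 + ((E * A + F * B - (C\<^sup>2 + D\<^sup>2)) / H + 2 * (D * A - C * B)\<^sup>2 / H\<^sup>2)"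
    "((E * A - D * D - (C * C - F * B)) * H - (D * A - C * B) * (2 * B * C - 2 * A * D)) / (H * H)
     = (E * A + F * B - (C\<^sup>2 + D\<^sup>2)) / H + 2 * (D * A - C * B)\<^sup>2 / H\<^sup>2"
proof -
  have H: "H > 0" by (simp add: H_def add_pos_nonneg)
  have N: "((E * A + C * C + (F * B + D * D)) * H - (C * A + D * B) * (2 * A * C + 2 * B * D))
     = 2 * (C\<^sup>2 + D\<^sup>2) + (E * A + F * B - (C\<^sup>2 + D\<^sup>2)) * H + 2 * (D * A - C * B)\<^sup>2"
    unfolding H_def by algebra
  have S: "x / H\<^sup>2 + (y / H + z / H\<^sup>2) = (x + y * H + z) / (H * H)" "y / H + z / H\<^sup>2 = (y * H + z) / (H * H)" for x y z
    using H by (simp_all add: field_simps power2_eq_square)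
  show "((E * A + C * C + (F * B + D * D)) * H - (C * A + D * B) * (2 * A * C + 2 * B * D)) / (H * H)
     = (2 * (C\<^sup>2 + D\<^sup>2)) / H\<^sup>2 + ((E * A + F * B - (C\<^sup>2 + D\<^sup>2)) / H + 2 * (D * A - C * B)\<^sup>2 / H\<^sup>2)"
    by (simp only: N S(1))
  have N: "((E * A - D * D - (C * C - F * B)) * H - (D * A - C * B) * (2 * B * C - 2 * A * D))
     = (E * A + F * B - (C\<^sup>2 + D\<^sup>2)) * H + 2 * (D * A - C * B)\<^sup>2" by algebra
  show "((E * A - D * D - (C * C - F * B)) * H - (D * A - C * B) * (2 * B * C - 2 * A * D)) / (H * H)
     = (E * A + F * B - (C\<^sup>2 + D\<^sup>2)) / H + 2 * (D * A - C * B)\<^sup>2 / H\<^sup>2"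
    by (simp only: N S(2))
qed

text \<open>
Together with the next lemma this says that the Laplacian of the potential is twice the square of
the spherical derivative.
\<close>

lemma Re_log_chordal_grad_deriv:
  assumes g: "g holomorphic_on UNIV"
  shows "((\<lambda>s. Re (log_chordal_grad g (Complex s t))) has_real_derivative
           2 * (spherical_deriv g (Complex s t))\<^sup>2 + neg_vertical_deriv2 g (Complex s t)) (at s)"
proof -
  have g': "deriv g holomorphic_on UNIV" using g by (intro holomorphic_deriv) auto
  note R = Re_Im_along_curve[OF g horizontal_line_deriv, simplified]
    Re_Im_along_curve[OF g' horizontal_line_deriv, simplified]
  let ?z = "Complex s t"
  have p: "1 + ((Re (g z))\<^sup>2 + (Im (g z))\<^sup>2) \<noteq> 0" for z
    by (metis add_pos_nonneg less_irrefl sum_power2_ge_zero zero_less_one)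
  have "((\<lambda>s. Re (log_chordal_grad g (Complex s t))) has_real_derivative
    ((Re (deriv (deriv g) ?z) * Re (g ?z) + Re (deriv g ?z) * Re (deriv g ?z)
      + (Im (deriv (deriv g) ?z) * Im (g ?z) + Im (deriv g ?z) * Im (deriv g ?z)))
        * (1 + ((Re (g ?z))\<^sup>2 + (Im (g ?z))\<^sup>2))
     - (Re (deriv g ?z) * Re (g ?z) + Im (deriv g ?z) * Im (g ?z)) *
        (2 * Re (g ?z) * Re (deriv g ?z) + 2 * Im (g ?z) * Im (deriv g ?z)))
      / ((1 + ((Re (g ?z))\<^sup>2 + (Im (g ?z))\<^sup>2)) * (1 + ((Re (g ?z))\<^sup>2 + (Im (g ?z))\<^sup>2)))) (at s)"
    unfolding Re_Im_log_chordal_grad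
    by (rule derivative_eq_intros R refl p | simp add: algebra_simps)+
  then show ?thesis
    unfolding chordal_gradient_algebra(1)
    by (simp add: spherical_deriv_def neg_vertical_deriv2_def cmod_power2 power_divide)
qed

lemma Im_log_chordal_grad_deriv:
  assumes g: "g holomorphic_on UNIV"
  shows "((\<lambda>t. Im (log_chordal_grad g (Complex s t))) has_real_derivative
           neg_vertical_deriv2 g (Complex s t)) (at t)"
proof -
  have g': "deriv g holomorphic_on UNIV" using g by (intro holomorphic_deriv) auto
  note R = Re_Im_along_curve[OF g vertical_line_deriv, simplified]
    Re_Im_along_curve[OF g' vertical_line_deriv, simplified]
  let ?z = "Complex s t"
  have p: "1 + ((Re (g z))\<^sup>2 + (Im (g z))\<^sup>2) \<noteq> 0" for z
    by (metis add_pos_nonneg less_irrefl sum_power2_ge_zero zero_less_one)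
  have "((\<lambda>t. Im (log_chordal_grad g (Complex s t))) has_real_derivative
    ((Re (deriv (deriv g) ?z) * Re (g ?z) - Im (deriv g ?z) * Im (deriv g ?z)
      - (Re (deriv g ?z) * Re (deriv g ?z) - Im (deriv (deriv g) ?z) * Im (g ?z)))
        * (1 + ((Re (g ?z))\<^sup>2 + (Im (g ?z))\<^sup>2))
     - (Im (deriv g ?z) * Re (g ?z) - Re (deriv g ?z) * Im (g ?z)) *
        (2 * Im (g ?z) * Re (deriv g ?z) - 2 * Re (g ?z) * Im (deriv g ?z)))
      / ((1 + ((Re (g ?z))\<^sup>2 + (Im (g ?z))\<^sup>2)) * (1 + ((Re (g ?z))\<^sup>2 + (Im (g ?z))\<^sup>2)))) (at t)"
    unfolding Re_Im_log_chordal_grad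
    by (rule derivative_eq_intros R refl p | simp add: algebra_simps)+
  then show ?thesis
    unfolding chordal_gradient_algebra(2)
    by (simp add: neg_vertical_deriv2_def cmod_power2)
qed

lemma vertical_integral_log_chordal_deriv:
  assumes g: "g holomorphic_on UNIV"
  shows "(vertical_integral (log_chordal g) has_real_derivative
           vertical_integral (\<lambda>z. Re (log_chordal_grad g z)) s) (at s)"
  by (rule vertical_integral_has_derivative[OF continuous_log_chordal[OF g] _ log_chordal_horizontal_deriv[OF g]])
     (intro continuous_intros continuous_log_chordal_grad g)

text \<open>
The integrand is the derivative of a function of period \<open>2 \<pi>\<close>.
\<close>

lemma vertical_integral_neg_vertical_deriv2:
  assumes g: "g holomorphic_on UNIV" and per: "\<And>z. g (z + 2 * pi * \<i>) = g z"
  shows "vertical_integral (neg_vertical_deriv2 g) s = 0"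
proof -
  have "deriv g (z + 2 * pi * \<i>) = deriv g z" for z
  proof -
    have "(g has_field_derivative deriv g (z + 2 * pi * \<i>)) (at (z + 2 * pi * \<i>))"
      using g by (auto intro: holomorphic_derivI)
    then have "((\<lambda>x. g (x + 2 * pi * \<i>)) has_field_derivative deriv g (z + 2 * pi * \<i>)) (at z)"
      by (simp add: DERIV_shift)
    then show ?thesis unfolding per by (metis DERIV_imp_deriv)
  qed
  then have "log_chordal_grad g (z + 2 * pi * \<i>) = log_chordal_grad g z" for z
    unfolding log_chordal_grad_def per by simp
  moreover have "Complex s (- pi) + 2 * pi * \<i> = Complex s pi" by (simp add: complex_eq_iff)
  ultimately have e: "log_chordal_grad g (Complex s pi) = log_chordal_grad g (Complex s (- pi))" by metis
  have "((\<lambda>t. neg_vertical_deriv2 g (Complex s t)) has_integral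
      (Im (log_chordal_grad g (Complex s pi)) - Im (log_chordal_grad g (Complex s (- pi))))) {- pi..pi}"
    by (rule fundamental_theorem_of_calculus)
       (use Im_log_chordal_grad_deriv[OF g] in \<open>auto intro: has_vector_derivative_at_within
         simp: has_real_derivative_iff_has_vector_derivative\<close>)
  then show ?thesis unfolding vertical_integral_def e by (simp add: integral_unique)
qed

text \<open>
Integrating the Laplacian over a vertical period removes the vertical second derivative. So the second
derivative of the vertical means is twice the spherical area of the line, which is the differential
form of the Ahlfors--Shimizu identity.
\<close>

lemma vertical_integral_slope_deriv:
  assumes g: "g holomorphic_on UNIV" and per: "\<And>z. g (z + 2 * pi * \<i>) = g z"
  shows "(vertical_integral (\<lambda>z. Re (log_chordal_grad g z)) has_real_derivative
           2 * vertical_integral (\<lambda>z. (spherical_deriv g z)\<^sup>2) s) (at s)"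
proof -
  have c1: "continuous_on UNIV (\<lambda>z. 2 * (spherical_deriv g z)\<^sup>2)"
    by (intro continuous_intros continuous_spherical_deriv g)
  have c2: "continuous_on UNIV (neg_vertical_deriv2 g)" by (rule continuous_neg_vertical_deriv2[OF g])
  have "vertical_integral (\<lambda>z. 2 * (spherical_deriv g z)\<^sup>2 + neg_vertical_deriv2 g z) s
      = vertical_integral (\<lambda>z. 2 * (spherical_deriv g z)\<^sup>2) s + vertical_integral (neg_vertical_deriv2 g) s"
    unfolding vertical_integral_def by (intro integral_add integrable_vertical c1 c2)
  also have "\<dots> = 2 * vertical_integral (\<lambda>z. (spherical_deriv g z)\<^sup>2) s"
    using vertical_integral_neg_vertical_deriv2[OF g per] by (simp add: vertical_integral_def)
  finally have e: "vertical_integral (\<lambda>z. 2 * (spherical_deriv g z)\<^sup>2 + neg_vertical_deriv2 g z) s = \<dots>" .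
  have "(vertical_integral (\<lambda>z. Re (log_chordal_grad g z)) has_real_derivative
     vertical_integral (\<lambda>z. 2 * (spherical_deriv g z)\<^sup>2 + neg_vertical_deriv2 g z) s) (at s)"
    by (rule vertical_integral_has_derivative[OF _ continuous_on_add[OF c1 c2] Re_log_chordal_grad_deriv[OF g]])
       (intro continuous_intros continuous_log_chordal_grad g)
  then show ?thesis unfolding e .
qed

abbreviation slope_integral :: "(complex \<Rightarrow> complex) \<Rightarrow> real \<Rightarrow> real" where
  "slope_integral g \<equiv> vertical_integral (\<lambda>z. Re (log_chordal_grad g z))"

lemma log_chordal_nonneg: "0 \<le> log_chordal g z"
  by (simp add: log_chordal_def)

lemma continuous_vertical_integral:
  assumes "continuous_on UNIV k"
  shows "continuous_on S (vertical_integral k)"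
proof -
  have c: "continuous_on (S \<times> cbox (- pi) pi) (\<lambda>(s, t). k (Complex s t))"
    unfolding split_beta
    by (rule continuous_on_compose2[OF assms]) (auto simp: Complex_eq intro!: continuous_intros)
  show ?thesis
    using integral_continuous_on_param[OF c] by (simp add: vertical_integral_def[abs_def])
qed

lemma slope_integral_mono:
  assumes g: "g holomorphic_on UNIV" and per: "\<And>z. g (z + 2 * pi * \<i>) = g z" and "s \<le> t"
  shows "slope_integral g s \<le> slope_integral g t"
proof (rule DERIV_nonneg_imp_nondecreasing[OF \<open>s \<le> t\<close>])
  fix x
  have "0 \<le> vertical_integral (\<lambda>z. (spherical_deriv g z)\<^sup>2) x"
    unfolding vertical_integral_def by (intro integral_nonneg)
      (auto intro!: integrable_vertical[of "\<lambda>z. (spherical_deriv g z)\<^sup>2"] continuous_intros continuous_spherical_deriv g)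
  then show "\<exists>y. (slope_integral g has_real_derivative y) (at x) \<and> 0 \<le> y"
    using vertical_integral_slope_deriv[OF g per] by fastforce
qed

lemma vertical_integral_log_chordal_convex:
  assumes g: "g holomorphic_on UNIV" and per: "\<And>z. g (z + 2 * pi * \<i>) = g z" and st: "s < t"
  shows "(t - s) * slope_integral g s \<le> vertical_integral (log_chordal g) t - vertical_integral (log_chordal g) s"
    "vertical_integral (log_chordal g) t - vertical_integral (log_chordal g) s \<le> (t - s) * slope_integral g t"
proof -
  obtain x where x: "s < x" "x < t"
    "vertical_integral (log_chordal g) t - vertical_integral (log_chordal g) s = (t - s) * slope_integral g x"
    using MVT2[OF st, of "vertical_integral (log_chordal g)" "slope_integral g"]
      vertical_integral_log_chordal_deriv[OF g] by auto
  have "slope_integral g s \<le> slope_integral g x" "slope_integral g x \<le> slope_integral g t"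
    using slope_integral_mono[OF g per] x by auto
  then show "(t - s) * slope_integral g s \<le> vertical_integral (log_chordal g) t - vertical_integral (log_chordal g) s"
    "vertical_integral (log_chordal g) t - vertical_integral (log_chordal g) s \<le> (t - s) * slope_integral g t"
    unfolding x(3) using st by auto
qed

text \<open>
Circular means of \<open>g\<close> about \<open>a\<close> become vertical means of the periodic function \<open>z \<mapsto> g (a + l e\<^sup>z)\<close>.
The logarithm of the radius is the natural variable, since the spherical area is conformally invariant.
\<close>

lemma exp_lift:
  fixes g :: "complex \<Rightarrow> complex" and a l :: complex
  assumes g: "g holomorphic_on UNIV"
  defines "G \<equiv> (\<lambda>z. g (a + l * exp z))"
  shows exp_lift_holomorphic: "G holomorphic_on UNIV"
    and exp_lift_periodic: "G (z + 2 * pi * \<i>) = G z"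
    and exp_lift_log_chordal: "log_chordal G z = log_chordal g (a + l * exp z)"
    and exp_lift_spherical_deriv: "spherical_deriv G z = spherical_deriv g (a + l * exp z) * cmod (l * exp z)"
proof -
  show "G holomorphic_on UNIV"
    unfolding G_def
    by (rule holomorphic_on_compose_gen[OF _ g, unfolded o_def]) (auto intro!: holomorphic_intros)
  show "G (z + 2 * pi * \<i>) = G z"
    by (simp add: G_def exp_add)
  show "log_chordal G z = log_chordal g (a + l * exp z)"
    by (simp add: G_def log_chordal_def)
  have "(g has_field_derivative deriv g (a + l * exp z)) (at (a + l * exp z))"
    using g by (auto intro: holomorphic_derivI)
  then have "((\<lambda>z. g (a + l * exp z)) has_field_derivative deriv g (a + l * exp z) * (l * exp z)) (at z)"
    by (rule DERIV_chain2) (auto intro!: derivative_eq_intros)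
  then have "deriv G z = deriv g (a + l * exp z) * (l * exp z)"
    unfolding G_def by (rule DERIV_imp_deriv)
  then show "spherical_deriv G z = spherical_deriv g (a + l * exp z) * cmod (l * exp z)"
    by (simp add: spherical_deriv_def norm_mult) (simp add: G_def)
qed

text \<open>
The means are convex, and they stay bounded as the radius shrinks to 0; a convex function with a negative
slope somewhere would be unbounded to the left of that point.
\<close>

lemma slope_integral_exp_lift_nonneg:
  assumes g: "g holomorphic_on UNIV" and l: "l \<noteq> 0"
  shows "0 \<le> slope_integral (\<lambda>z. g (a + l * exp z)) s"
proof (rule ccontr)
  define G where "G = (\<lambda>z. g (a + l * exp z))"
  note G = exp_lift_holomorphic[OF g, of a l, folded G_def]
  have GL: "log_chordal G z = log_chordal g (a + l * exp z)" for z
    using exp_lift_log_chordal[OF g, of a l] by (simp add: G_def)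
  have per: "G (z + 2 * pi * \<i>) = G z" for z using exp_lift_periodic[OF g, of a l] by (simp add: G_def)
  define \<sigma> where "\<sigma> = - slope_integral G s"
  assume "\<not> ?thesis"
  then have \<sigma>: "\<sigma> > 0" by (simp add: \<sigma>_def G_def)
  have "compact (log_chordal g ` cball a (cmod l * exp s))"
    by (intro compact_continuous_image continuous_on_subset[OF continuous_log_chordal[OF g]]) auto
  then obtain B where B: "\<And>z. z \<in> cball a (cmod l * exp s) \<Longrightarrow> log_chordal g z \<le> B"
    by (meson bounded_imp_bdd_above compact_imp_bounded bdd_above.unfold image_eqI)
  have bound: "vertical_integral (log_chordal G) t \<le> 2 * pi * B" if "t \<le> s" for t
  proof (rule vertical_integral_upper[OF continuous_log_chordal[OF G]])
    fix u
    show "log_chordal G (Complex t u) \<le> B"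
      unfolding GL
      by (rule B) (use that in \<open>simp add: dist_norm norm_mult mult_left_mono\<close>)
  qed
  \<comment> \<open>The left shift by \<open>r\<close> is long enough to violate the bound \<open>2 \<pi> B\<close>.\<close>
  define r where "r = (\<bar>2 * pi * B\<bar> + \<bar>vertical_integral (log_chordal G) s\<bar> + 1) / \<sigma>"
  have r: "r > 0" using \<sigma> by (simp add: r_def add_nonneg_pos)
  have "vertical_integral (log_chordal G) s - vertical_integral (log_chordal G) (s - r)
      \<le> (s - (s - r)) * slope_integral G s"
    by (rule vertical_integral_log_chordal_convex(2)[OF G per]) (use r in auto)
  also have "\<dots> = - (r * \<sigma>)" by (simp add: \<sigma>_def)
  also have "r * \<sigma> = \<bar>2 * pi * B\<bar> + \<bar>vertical_integral (log_chordal G) s\<bar> + 1"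
    using \<sigma> by (simp add: r_def)
  finally show False using bound[of "s - r"] r by auto
qed

lemma vertical_integral_exp_lift_mono:
  assumes g: "g holomorphic_on UNIV" and l: "l \<noteq> 0" and "s \<le> t"
  shows "vertical_integral (log_chordal (\<lambda>z. g (a + l * exp z))) s
       \<le> vertical_integral (log_chordal (\<lambda>z. g (a + l * exp z))) t"
  by (rule DERIV_nonneg_imp_nondecreasing[OF \<open>s \<le> t\<close>])
     (use vertical_integral_log_chordal_deriv[OF exp_lift_holomorphic[OF g]]
        slope_integral_exp_lift_nonneg[OF g l] in blast)

text \<open>
The means increase with the radius and converge to the value at the centre as the radius tends to 0.
\<close>

lemma log_chordal_sub_mean_value:
  assumes g: "g holomorphic_on UNIV" and l: "l \<noteq> 0"
  shows "2 * pi * log_chordal g a \<le> vertical_integral (log_chordal (\<lambda>z. g (a + l * exp z))) s"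
proof (rule field_le_epsilon)
  fix e :: real assume "e > 0"
  define G where "G = (\<lambda>z. g (a + l * exp z))"
  note G = exp_lift_holomorphic[OF g, of a l, folded G_def]
  have GL: "log_chordal G z = log_chordal g (a + l * exp z)" for z
    using exp_lift_log_chordal[OF g, of a l] by (simp add: G_def)
  have "isCont (log_chordal g) a"
    using continuous_log_chordal[OF g] by (simp add: continuous_on_eq_continuous_at)
  moreover have "e / (2 * pi) > 0" using \<open>e > 0\<close> by simp
  ultimately obtain d where d: "d > 0" "\<And>z. dist z a < d \<Longrightarrow> dist (log_chordal g z) (log_chordal g a) < e / (2 * pi)"
    unfolding continuous_at_eps_delta by blast
  define t where "t = min s (ln (d / (2 * cmod l)))"
  have "exp t \<le> exp (ln (d / (2 * cmod l)))" by (simp add: t_def)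
  also have "\<dots> = d / (2 * cmod l)" using d l by simp
  finally have "cmod l * exp t \<le> d / 2" using l by (simp add: field_simps)
  with d have small: "cmod l * exp t < d" by linarith
  have "2 * pi * (log_chordal g a - e / (2 * pi)) \<le> vertical_integral (log_chordal G) t"
  proof (rule vertical_integral_lower[OF continuous_log_chordal[OF G]])
    fix u
    show "log_chordal g a - e / (2 * pi) \<le> log_chordal G (Complex t u)"
      unfolding GL
      using d(2)[of "a + l * exp (Complex t u)"] small by (simp add: dist_norm norm_mult)
  qed
  also have "\<dots> \<le> vertical_integral (log_chordal G) s"
    unfolding G_def by (rule vertical_integral_exp_lift_mono[OF g l]) (simp add: t_def)
  finally show "2 * pi * log_chordal g a \<le> vertical_integral (log_chordal (\<lambda>z. g (a + l * exp z))) s + e"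
    by (simp add: G_def right_diff_distrib)
qed

section \<open>The maximum modulus\<close>

lemma max_modulus_ge:
  assumes "continuous_on UNIV g" "cmod z = r"
  shows "cmod (g z) \<le> max_modulus r g"
proof -
  have "compact ((\<lambda>z. cmod (g z)) ` sphere 0 r)"
    by (intro compact_continuous_image continuous_intros continuous_on_subset[OF assms(1)]) auto
  then show ?thesis unfolding max_modulus_def using assms(2)
    by (intro cSUP_upper bounded_imp_bdd_above compact_imp_bounded) auto
qed

lemma max_modulus_attained:
  assumes "continuous_on UNIV g" "0 \<le> r"
  obtains z where "cmod z = r" "cmod (g z) = max_modulus r g"
proof -
  have "complex_of_real r \<in> sphere 0 r" using assms(2) by simp
  then have "sphere (0::complex) r \<noteq> {}" by blast
  moreover have "continuous_on (sphere 0 r) (\<lambda>z. cmod (g z))"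
    by (intro continuous_intros continuous_on_subset[OF assms(1)]) auto
  ultimately obtain z where z: "z \<in> sphere 0 r" "\<forall>y\<in>sphere 0 r. cmod (g y) \<le> cmod (g z)"
    using continuous_attains_sup[of "sphere (0::complex) r" "\<lambda>z. cmod (g z)"] compact_sphere by blast
  then have "max_modulus r g = cmod (g z)"
    unfolding max_modulus_def by (intro cSup_eq_maximum) auto
  with z show ?thesis by (intro that[of z]) auto
qed

lemma entire_continuous: "g holomorphic_on UNIV \<Longrightarrow> continuous_on UNIV g"
  by (rule holomorphic_on_imp_continuous_on)

lemma max_modulus_ge_cball:
  assumes g: "g holomorphic_on UNIV" and z: "cmod z \<le> r"
  shows "cmod (g z) \<le> max_modulus r g"
proof (rule maximum_modulus_frontier[of g "cball 0 r"])
  show "cmod (g w) \<le> max_modulus r g" if "w \<in> frontier (cball 0 r)" for w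
    using that by (intro max_modulus_ge[OF entire_continuous[OF g]]) (auto simp: frontier_cball)
qed (use z g in \<open>auto intro: holomorphic_on_subset continuous_on_subset entire_continuous\<close>)

lemma max_modulus_mono:
  assumes g: "g holomorphic_on UNIV" and "0 \<le> r" "r \<le> s"
  shows "max_modulus r g \<le> max_modulus s g"
proof -
  obtain z where "cmod z = r" "cmod (g z) = max_modulus r g"
    using max_modulus_attained[OF entire_continuous[OF g] \<open>0 \<le> r\<close>] .
  with max_modulus_ge_cball[OF g, of z s] \<open>r \<le> s\<close> show ?thesis by simp
qed

lemma max_modulus_nonneg:
  assumes g: "g holomorphic_on UNIV" and "0 \<le> r"
  shows "0 \<le> max_modulus r g"
  using max_modulus_attained[OF entire_continuous[OF g] \<open>0 \<le> r\<close>] by (metis norm_ge_zero)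

section \<open>Spherical area of annuli\<close>

text \<open>
This bounds the maximum of the potential by a mean on a circle that is larger by the factor \<open>e\<close>. For the
lifted function \<open>z \<mapsto> g (l e\<^sup>z)\<close>, the value at 0 is at most a constant times the integral over the
unit disc, by the sub-mean-value property. The unit disc lies in the rectangle \<open>|Re z| < 1\<close>,
\<open>|Im z| < \<pi>\<close>, and the integral over that rectangle is an integral of circular means of \<open>g\<close>.
\<close>

lemma log_chordal_le_vertical_integral:
  assumes g: "g holomorphic_on UNIV" and l: "l \<noteq> 0"
  shows "pi * exp (- 2) * log_chordal g l \<le> vertical_integral (log_chordal (\<lambda>z. g (l * exp z))) 1"
proof -
  define G where "G = (\<lambda>z. g (l * exp z))"
  have G: "G holomorphic_on UNIV" using exp_lift_holomorphic[OF g, of 0 l] by (simp add: G_def)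
  define w where "w = log_chordal G"
  have cw: "continuous_on UNIV w" unfolding w_def by (rule continuous_log_chordal[OF G])
  then have wm: "w \<in> borel_measurable borel" by (rule borel_measurable_continuous_onI)
  have w0: "0 \<le> w z" for z by (simp add: w_def log_chordal_nonneg)
  define k where "k = (\<lambda>z. w (exp z) * (cmod (exp z))\<^sup>2)"
  have ck: "continuous_on UNIV k" unfolding k_def
    by (intro continuous_intros continuous_on_compose2[OF cw]) auto
  have low: "2 * pi * w 0 * exp (- 2) \<le> vertical_integral k s" if "s \<in> {-1..0}" for s
  proof -
    have ce: "continuous_on UNIV (log_chordal (\<lambda>z. G (0 + 1 * exp z)))"
      by (rule continuous_log_chordal[OF exp_lift_holomorphic[OF G]])
    have "2 * pi * w 0 \<le> vertical_integral (log_chordal (\<lambda>z. G (0 + 1 * exp z))) s"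
      unfolding w_def by (rule log_chordal_sub_mean_value[OF G]) simp
    also have "log_chordal (\<lambda>z. G (0 + 1 * exp z)) = (\<lambda>z. w (exp z))"
      by (simp add: w_def log_chordal_def fun_eq_iff)
    finally have 1: "2 * pi * w 0 \<le> vertical_integral (\<lambda>z. w (exp z)) s" .
    have "vertical_integral k s = vertical_integral (\<lambda>z. w (exp z)) s * (exp s)\<^sup>2"
      by (simp add: vertical_integral_def k_def)
    also have "\<dots> \<ge> (2 * pi * w 0) * exp (- 2)"
    proof (rule mult_mono[OF 1])
      have "exp (- 2) \<le> exp (2 * s)" using that by simp
      also have "\<dots> = (exp s)\<^sup>2" by (simp add: exp_double)
      finally show "exp (- 2) \<le> (exp s)\<^sup>2" .
      show "0 \<le> vertical_integral (\<lambda>z. w (exp z)) s" using 1 w0[of 0] by (meson mult_nonneg_nonneg order_trans pi_ge_zero zero_le_numeral)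
    qed simp
    finally show ?thesis .
  qed
  have "integral {- 1..0::real} (\<lambda>_. 2 * pi * w 0 * exp (- 2)) \<le> integral {- 1..0} (vertical_integral k)"
    by (intro integral_le integrable_continuous_interval continuous_vertical_integral ck low) auto
  then have "2 * pi * w 0 * exp (- 2) \<le> integral {- 1..0} (vertical_integral k)" by simp
  then have "ennreal (2 * pi * w 0 * exp (- 2)) \<le> ennreal (integral {- 1..0} (vertical_integral k))"
    by (rule ennreal_leI)
  also have "\<dots> = (\<integral>\<^sup>+z\<in>{z. - 1 < Re z \<and> Re z < 0 \<and> - pi < Im z \<and> Im z < pi}. ennreal (k z) \<partial>lborel)"
    unfolding vertical_integral_def[abs_def]
    by (rule nn_integral_complex_rectangle[OF ck, symmetric]) (simp add: k_def w0)
  also have "\<dots> \<le> (\<integral>\<^sup>+z\<in>{z. exp (- 1) < cmod z \<and> cmod z < 1}. ennreal (w z) \<partial>lborel)"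
    using nn_integral_log_polar_le[where l = 1 and h = w and \<alpha> = "- 1" and \<beta> = 0 and a = 0, OF _ wm w0]
    unfolding k_def by simp
  also have "\<dots> \<le> (\<integral>\<^sup>+z\<in>{z. - 1 < Re z \<and> Re z < 1 \<and> - pi < Im z \<and> Im z < pi}. ennreal (w z) \<partial>lborel)"
  proof (rule nn_integral_mono)
    fix z
    have "- 1 < Re z \<and> Re z < 1 \<and> - pi < Im z \<and> Im z < pi" if "cmod z < 1"
      using abs_Re_le_cmod[of z] abs_Im_le_cmod[of z] that pi_gt3 by auto
    then show "ennreal (w z) * indicator {z. exp (- 1) < cmod z \<and> cmod z < 1} z
        \<le> ennreal (w z) * indicator {z. - 1 < Re z \<and> Re z < 1 \<and> - pi < Im z \<and> Im z < pi} z"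
      by (auto split: split_indicator)
  qed
  also have "\<dots> = ennreal (integral {- 1..1} (vertical_integral w))"
    unfolding vertical_integral_def[abs_def]
    by (rule nn_integral_complex_rectangle[OF cw]) (simp add: w0)
  also have "integral {- 1..1} (vertical_integral w) \<le> integral {- 1..1::real} (\<lambda>_. vertical_integral w 1)"
  proof (intro integral_le integrable_continuous_interval continuous_vertical_integral cw)
    fix s :: real assume "s \<in> {- 1..1}"
    then show "vertical_integral w s \<le> vertical_integral w 1"
      using vertical_integral_exp_lift_mono[OF g l, of s 1 0] by (simp add: w_def G_def)
  qed auto
  finally have "ennreal (2 * pi * w 0 * exp (- 2)) \<le> ennreal (2 * vertical_integral w 1)"
    by (simp add: ennreal_leI)
  moreover have "0 \<le> vertical_integral w 1"
    using vertical_integral_lower[OF cw, of 0 1] w0 by simp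
  ultimately have "2 * pi * w 0 * exp (- 2) \<le> 2 * vertical_integral w 1"
    by (subst (asm) ennreal_le_iff) auto
  moreover have "w 0 = log_chordal g l" by (simp add: w_def G_def log_chordal_def)
  ultimately show ?thesis by (simp add: w_def G_def algebra_simps)
qed

lemma spherical_area_annulus_ge_slope:
  assumes g: "g holomorphic_on UNIV" and l: "l \<noteq> 0" and "\<alpha> \<le> \<beta>"
  shows "ennreal ((slope_integral (\<lambda>z. g (l * exp z)) \<beta> - slope_integral (\<lambda>z. g (l * exp z)) \<alpha>) / (2 * pi))
     \<le> spherical_area {z. cmod l * exp \<alpha> < cmod z \<and> cmod z < cmod l * exp \<beta>} g"
proof -
  define G where "G = (\<lambda>z. g (l * exp z))"
  have G: "G holomorphic_on UNIV" using exp_lift_holomorphic[OF g, of 0 l] by (simp add: G_def)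
  have per: "G (z + 2 * pi * \<i>) = G z" for z using exp_lift_periodic[OF g, of 0 l] by (simp add: G_def)
  define k where "k = (\<lambda>z. (spherical_deriv G z)\<^sup>2)"
  have ck: "continuous_on UNIV k" unfolding k_def
    by (intro continuous_intros continuous_spherical_deriv G)
  have k: "k z = (spherical_deriv g (0 + l * exp z))\<^sup>2 * (cmod (l * exp z))\<^sup>2" for z
    using exp_lift_spherical_deriv[OF g, of 0 l] by (simp add: k_def G_def power_mult_distrib)
  have "((\<lambda>s. 2 * vertical_integral k s) has_integral (slope_integral G \<beta> - slope_integral G \<alpha>)) {\<alpha>..\<beta>}"
    using vertical_integral_slope_deriv[OF G per]
    by (intro fundamental_theorem_of_calculus \<open>\<alpha> \<le> \<beta>\<close>)
       (auto simp: k_def has_real_derivative_iff_has_vector_derivative intro: has_vector_derivative_at_within)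
  then have "integral {\<alpha>..\<beta>} (\<lambda>s. 2 * vertical_integral k s) = slope_integral G \<beta> - slope_integral G \<alpha>"
    by (rule integral_unique)
  then have "slope_integral G \<beta> - slope_integral G \<alpha> = 2 * integral {\<alpha>..\<beta>} (vertical_integral k)"
    by simp
  then have "(slope_integral G \<beta> - slope_integral G \<alpha>) / (2 * pi) = 1 / pi * integral {\<alpha>..\<beta>} (vertical_integral k)"
    by simp
  then have "ennreal ((slope_integral G \<beta> - slope_integral G \<alpha>) / (2 * pi))
      = ennreal (1 / pi) * ennreal (integral {\<alpha>..\<beta>} (vertical_integral k))"
    by (simp only:) (simp add: ennreal_mult'[symmetric])
  also have "ennreal (integral {\<alpha>..\<beta>} (vertical_integral k))
     = (\<integral>\<^sup>+z\<in>{z. \<alpha> < Re z \<and> Re z < \<beta> \<and> - pi < Im z \<and> Im z < pi}. ennreal (k z) \<partial>lborel)"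
    unfolding vertical_integral_def[abs_def]
    by (rule nn_integral_complex_rectangle[OF ck, symmetric]) (simp add: k_def)
  also have "\<dots> \<le> (\<integral>\<^sup>+z\<in>{z. cmod l * exp \<alpha> < cmod (z - 0) \<and> cmod (z - 0) < cmod l * exp \<beta>}.
       ennreal ((spherical_deriv g z)\<^sup>2) \<partial>lborel)"
    unfolding k
    by (rule nn_integral_log_polar_le[OF l])
       (auto intro!: borel_measurable_continuous_onI continuous_intros continuous_spherical_deriv g)
  finally show ?thesis
    unfolding spherical_area_def G_def by (simp add: mult_left_mono)
qed

lemma log_chordal_ge: "g z \<noteq> 0 \<Longrightarrow> ln (cmod (g z)) \<le> log_chordal g z"
proof -
  assume nz: "g z \<noteq> 0"
  then have "ln ((cmod (g z))\<^sup>2) \<le> ln (1 + (cmod (g z))\<^sup>2)" by (intro ln_mono) (auto simp: add_pos_nonneg)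
  then show ?thesis using nz by (simp add: log_chordal_def ln_realpow)
qed

lemma log_chordal_le:
  assumes "cmod (g z) \<le> x" "1 \<le> x"
  shows "log_chordal g z \<le> ln x + ln 2 / 2"
proof -
  have "(cmod (g z))\<^sup>2 \<le> x\<^sup>2" "1 \<le> x\<^sup>2" using assms by (auto intro: power_mono)
  then have "ln (1 + (cmod (g z))\<^sup>2) \<le> ln (2 * x\<^sup>2)"
    using one_plus_sq_pos by (intro ln_mono) auto
  also have "\<dots> = ln 2 + 2 * ln x" using assms by (simp add: ln_mult ln_realpow)
  finally show ?thesis by (simp add: log_chordal_def)
qed

text \<open>
The area is the increment of the slope of the means between the radii \<open>P/e\<close> and \<open>e Q\<close>. By convexity the slope
at \<open>e Q\<close> is at least the difference quotient between \<open>P\<close> and \<open>e Q\<close>, where the mean at \<open>e Q\<close> is large,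
and the slope at \<open>P/e\<close> is at most the difference quotient between \<open>P/e\<close> and \<open>P\<close>, which is controlled by
the mean at \<open>P\<close>.
\<close>

proposition spherical_area_annulus_ge:
  assumes g: "g holomorphic_on UNIV" and PQ: "0 < P" "P < Q"
    and X: "max_modulus P g \<le> X" "1 \<le> X" and Y: "Y \<le> max_modulus Q g" "0 < Y"
  shows "ennreal (exp (- 2) / 2 * ln Y / (1 + ln (Q / P)) - 2 * ln X - ln 2)
     \<le> spherical_area {z. P / exp 1 < cmod z \<and> cmod z < exp 1 * Q} g"
proof -
  have cg: "continuous_on UNIV g" using g by (rule holomorphic_on_imp_continuous_on)
  \<comment> \<open>The lift is normalised so that the point 0 corresponds to a maximum point \<open>l\<close> of \<open>|g|\<close> on \<open>|z| = Q\<close>.\<close>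
  obtain l where l: "cmod l = Q" "cmod (g l) = max_modulus Q g"
    using max_modulus_attained[OF cg, of Q] PQ by auto
  have l0: "l \<noteq> 0" using l PQ by auto
  define G where "G = (\<lambda>z. g (l * exp z))"
  have G: "G holomorphic_on UNIV" using exp_lift_holomorphic[OF g, of 0 l] by (simp add: G_def)
  have per: "G (z + 2 * pi * \<i>) = G z" for z using exp_lift_periodic[OF g, of 0 l] by (simp add: G_def)
  define J where "J = vertical_integral (log_chordal G)"
  \<comment> \<open>In the logarithmic variable the radii \<open>P/e\<close>, \<open>P\<close> and \<open>e Q\<close> are \<open>\<gamma> - 1\<close>, \<open>\<gamma>\<close> and 1.\<close>
  define \<gamma> where "\<gamma> = ln (P / Q)"
  define D where "D = 1 + ln (Q / P)"
  have D: "D = 1 - \<gamma>" using PQ by (simp add: D_def \<gamma>_def ln_div)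
  have D1: "1 \<le> D" using PQ by (simp add: D_def)
  have J0: "0 \<le> J s" for s
    unfolding J_def using vertical_integral_lower[OF continuous_log_chordal[OF G], of 0 s] log_chordal_nonneg by simp
  have c1: "J 1 - J \<gamma> \<le> D * slope_integral G 1"
    unfolding J_def D by (rule vertical_integral_log_chordal_convex(2)[OF G per]) (use D D1 in simp)
  have c2: "slope_integral G (\<gamma> - 1) \<le> J \<gamma> - J (\<gamma> - 1)"
    unfolding J_def using vertical_integral_log_chordal_convex(1)[OF G per, of "\<gamma> - 1" \<gamma>] by simp
  have "g l \<noteq> 0" using l(2) Y by auto
  then have "ln (max_modulus Q g) \<le> log_chordal g l"
    using log_chordal_ge[of g l] l by simp
  moreover have "ln Y \<le> ln (max_modulus Q g)" using Y by (intro ln_mono) auto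
  ultimately have "ln Y \<le> log_chordal g l" by linarith
  then have "pi * exp (- 2) * ln Y \<le> pi * exp (- 2) * log_chordal g l"
    by (intro mult_left_mono) auto
  also have "\<dots> \<le> J 1" unfolding J_def G_def by (rule log_chordal_le_vertical_integral[OF g l0])
  finally have J1: "pi * exp (- 2) * ln Y \<le> J 1" .
  have J\<gamma>: "J \<gamma> \<le> 2 * pi * (ln X + ln 2 / 2)"
    unfolding J_def
  proof (rule vertical_integral_upper[OF continuous_log_chordal[OF G]])
    fix t
    have "cmod (l * exp (Complex \<gamma> t)) = P" using PQ by (simp add: norm_mult l \<gamma>_def)
    then show "log_chordal G (Complex \<gamma> t) \<le> ln X + ln 2 / 2"
      unfolding G_def using max_modulus_ge[OF cg] X by (intro log_chordal_le) (auto intro: order_trans)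
  qed
  have "(J 1 - J \<gamma>) / D \<le> slope_integral G 1"
    using c1 D1 by (simp add: field_simps)
  then have "slope_integral G 1 - slope_integral G (\<gamma> - 1) \<ge> J 1 / D - (J \<gamma> / D + J \<gamma>)"
    using c2 J0[of "\<gamma> - 1"] by (simp add: diff_divide_distrib)
  moreover have "J \<gamma> / D \<le> J \<gamma> / 1" using D1 J0[of \<gamma>] by (intro divide_left_mono) auto
  moreover have "pi * exp (- 2) * ln Y / D \<le> J 1 / D"
    using J1 D1 by (simp add: divide_right_mono)
  ultimately have "slope_integral G 1 - slope_integral G (\<gamma> - 1) \<ge>
      pi * exp (- 2) * ln Y / D - 2 * (2 * pi * (ln X + ln 2 / 2))"
    using J\<gamma> by simp
  then have "(slope_integral G 1 - slope_integral G (\<gamma> - 1)) / (2 * pi) \<ge>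
      (pi * exp (- 2) * ln Y / D - 2 * (2 * pi * (ln X + ln 2 / 2))) / (2 * pi)"
    by (simp add: divide_right_mono)
  also have "(pi * exp (- 2) * ln Y / D - 2 * (2 * pi * (ln X + ln 2 / 2))) / (2 * pi)
     = exp (- 2) / 2 * ln Y / D - 2 * ln X - ln 2"
    using D1 by (simp add: field_simps)
  finally have "ennreal (exp (- 2) / 2 * ln Y / D - 2 * ln X - ln 2)
     \<le> ennreal ((slope_integral G 1 - slope_integral G (\<gamma> - 1)) / (2 * pi))"
    by (rule ennreal_leI)
  also have "\<dots> \<le> spherical_area {z. cmod l * exp (\<gamma> - 1) < cmod z \<and> cmod z < cmod l * exp 1} g"
    unfolding G_def by (rule spherical_area_annulus_ge_slope[OF g l0]) (use D D1 in simp)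
  also have "cmod l * exp (\<gamma> - 1) = P / exp 1"
    using PQ by (simp add: l \<gamma>_def exp_diff)
  finally show ?thesis by (simp add: D_def l mult.commute)
qed

section \<open>Growth of transcendental entire functions\<close>

lemma transcendental_entire_holomorphic: "transcendental_entire f \<Longrightarrow> f holomorphic_on UNIV"
  by (simp add: transcendental_entire_def)

lemma transcendental_entire_coefficients:
  assumes f: "transcendental_entire f"
  shows "\<exists>p\<ge>N. (deriv ^^ p) f 0 \<noteq> 0"
proof (rule ccontr)
  assume *: "\<not> ?thesis"
  have "f z = poly (\<Sum>n<N. monom ((deriv ^^ n) f 0 / fact n) n) z" for z
  proof -
    have "f holomorphic_on ball 0 (cmod z + 1)"
      using transcendental_entire_holomorphic[OF f] by (rule holomorphic_on_subset) auto
    then have "(\<lambda>n. (deriv ^^ n) f 0 / fact n * (z - 0) ^ n) sums f z"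
      by (rule holomorphic_power_series) auto
    moreover have "(\<lambda>n. (deriv ^^ n) f 0 / fact n * (z - 0) ^ n) sums (\<Sum>n<N. (deriv ^^ n) f 0 / fact n * (z - 0) ^ n)"
      by (rule sums_finite) (use * in auto)
    ultimately have "f z = (\<Sum>n<N. (deriv ^^ n) f 0 / fact n * (z - 0) ^ n)" by (rule sums_unique2)
    then show ?thesis by (simp add: poly_sum poly_monom)
  qed
  with f show False unfolding transcendental_entire_def by blast
qed

text \<open>
By Cauchy's inequalities each non-vanishing Taylor coefficient of degree \<open>p\<close> gives a lower bound of order
\<open>r\<^sup>p\<close>, and there are such coefficients of arbitrarily large degree.
\<close>

lemma max_modulus_superpolynomial:
  assumes f: "transcendental_entire f"
  shows "eventually (\<lambda>r. B * r ^ N \<le> max_modulus r f) at_top"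
proof -
  note hol = transcendental_entire_holomorphic[OF f]
  obtain p where p: "p \<ge> Suc N" "(deriv ^^ p) f 0 \<noteq> 0"
    using transcendental_entire_coefficients[OF f] by blast
  define c where "c = cmod ((deriv ^^ p) f 0) / fact p"
  have c: "c > 0" using p by (simp add: c_def)
  have low: "c * r ^ p \<le> max_modulus r f" if "r > 0" for r
  proof -
    have "cmod ((deriv ^^ p) f 0) \<le> fact p * max_modulus r f / r ^ p"
      using that hol by (intro Cauchy_inequality)
       (auto intro: holomorphic_on_subset continuous_on_subset entire_continuous max_modulus_ge_cball)
    then show ?thesis using that by (simp add: c_def field_simps)
  qed
  show ?thesis
    using eventually_ge_at_top[of "max 1 (\<bar>B\<bar> / c)"]
  proof eventually_elim
    case (elim r)
    then have r: "1 \<le> r" "\<bar>B\<bar> \<le> c * r" using c by (auto simp: field_simps)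
    have "B * r ^ N \<le> (c * r) * r ^ N" using r by (intro mult_right_mono) auto
    also have "\<dots> = c * r ^ Suc N" by simp
    also have "\<dots> \<le> c * r ^ p" using r p c by (intro mult_left_mono power_increasing) auto
    also have "\<dots> \<le> max_modulus r f" using r by (intro low) auto
    finally show ?case .
  qed
qed

lemma divided_difference:
  assumes f: "f holomorphic_on UNIV"
  obtains f1 where "f1 holomorphic_on UNIV"
    "\<And>r. 0 \<le> r \<Longrightarrow> r * max_modulus r f1 \<le> max_modulus r f + cmod (f 0)"
    "\<And>r. 0 \<le> r \<Longrightarrow> r * max_modulus r f1 \<ge> max_modulus r f - cmod (f 0)"
proof
  define f1 where "f1 = (\<lambda>z. if z = 0 then deriv f 0 else (f z - f 0) / (z - 0))"
  show h: "f1 holomorphic_on UNIV" unfolding f1_def by (rule pole_lemma_open[OF f]) simp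
  have e: "z * f1 z = f z - f 0" for z by (simp add: f1_def)
  fix r :: real assume r: "0 \<le> r"
  obtain z where z: "cmod z = r" "cmod (f1 z) = max_modulus r f1"
    using max_modulus_attained[OF entire_continuous[OF h] r] .
  have "r * max_modulus r f1 = cmod (f z - f 0)" using z e[of z] by (metis norm_mult)
  also have "\<dots> \<le> cmod (f z) + cmod (f 0)" by (rule norm_triangle_ineq4)
  also have "cmod (f z) \<le> max_modulus r f" using z by (intro max_modulus_ge_cball f) auto
  finally show "r * max_modulus r f1 \<le> max_modulus r f + cmod (f 0)" by simp
  obtain z where z: "cmod z = r" "cmod (f z) = max_modulus r f"
    using max_modulus_attained[OF entire_continuous[OF f] r] .
  have "max_modulus r f - cmod (f 0) \<le> cmod (z * f1 z)"
    unfolding e using z norm_triangle_ineq2[of "f z" "f 0"] by simp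
  also have "\<dots> = r * cmod (f1 z)" by (simp add: norm_mult z)
  also have "\<dots> \<le> r * max_modulus r f1" using z r by (intro mult_left_mono max_modulus_ge_cball h) auto
  finally show "r * max_modulus r f1 \<ge> max_modulus r f - cmod (f 0)" .
qed

text \<open>
If \<open>f\<close> vanished to second order at 0, then \<open>M(\<mu> r, f) \<ge> \<mu>\<^sup>2 M(r, f)\<close> by the maximum principle applied to
\<open>f(z)/z\<^sup>2\<close>. In general this is applied to the second divided difference at 0, at the cost of an error that
is linear in \<open>r\<close>. One division would only give the factor \<open>\<mu>\<close>, which is not enough in the sequel.
\<close>

lemma max_modulus_dilation:
  assumes f: "f holomorphic_on UNIV"
  obtains a where "0 \<le> a"
    "\<And>\<mu> r. 1 \<le> \<mu> \<Longrightarrow> 1 \<le> r \<Longrightarrow> \<mu>\<^sup>2 * max_modulus r f - 4 * \<mu>\<^sup>2 * a * r \<le> max_modulus (\<mu> * r) f"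
proof -
  obtain f1 where f1: "f1 holomorphic_on UNIV"
    "\<And>r. 0 \<le> r \<Longrightarrow> r * max_modulus r f1 \<le> max_modulus r f + cmod (f 0)"
    "\<And>r. 0 \<le> r \<Longrightarrow> r * max_modulus r f1 \<ge> max_modulus r f - cmod (f 0)"
    using divided_difference[OF f] by blast
  obtain f2 where f2: "f2 holomorphic_on UNIV"
    "\<And>r. 0 \<le> r \<Longrightarrow> r * max_modulus r f2 \<le> max_modulus r f1 + cmod (f1 0)"
    "\<And>r. 0 \<le> r \<Longrightarrow> r * max_modulus r f2 \<ge> max_modulus r f1 - cmod (f1 0)"
    using divided_difference[OF f1(1)] by blast
  define a where "a = cmod (f 0) + cmod (f1 0)"
  have a: "cmod (f 0) \<le> a" "cmod (f1 0) \<le> a" by (auto simp: a_def)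
  show ?thesis
  proof
    show a0: "0 \<le> a" by (simp add: a_def)
    fix \<mu> r :: real assume \<mu>: "1 \<le> \<mu>" and r: "1 \<le> r"
    have r\<mu>: "r \<le> \<mu> * r" "0 \<le> \<mu> * r" using \<mu> r by auto
    have "\<mu> * (max_modulus r f1 - cmod (f1 0)) \<le> \<mu> * (r * max_modulus r f2)"
      using \<mu> r by (intro mult_left_mono f2) auto
    also have "\<dots> \<le> \<mu> * (r * max_modulus (\<mu> * r) f2)"
      using \<mu> r r\<mu> by (intro mult_left_mono max_modulus_mono f2) auto
    also have "\<dots> \<le> max_modulus (\<mu> * r) f1 + cmod (f1 0)"
      using f2(2)[OF r\<mu>(2)] by (simp add: mult.assoc)
    finally have "\<mu> * (max_modulus r f1 - cmod (f1 0)) \<le> max_modulus (\<mu> * r) f1 + cmod (f1 0)" .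
    moreover have "\<mu> * cmod (f1 0) \<le> \<mu> * a" using a \<mu> by (intro mult_left_mono) auto
    ultimately have 1: "\<mu> * max_modulus r f1 \<le> max_modulus (\<mu> * r) f1 + (\<mu> * a + a)"
      using a by (simp add: right_diff_distrib)
    have "\<mu>\<^sup>2 * (max_modulus r f - cmod (f 0)) \<le> \<mu>\<^sup>2 * (r * max_modulus r f1)"
      using \<mu> r by (intro mult_left_mono f1) auto
    also have "\<dots> = \<mu> * r * (\<mu> * max_modulus r f1)" by (simp add: power2_eq_square algebra_simps)
    also have "\<dots> \<le> \<mu> * r * (max_modulus (\<mu> * r) f1 + (\<mu> * a + a))"
      using 1 r\<mu> by (intro mult_left_mono) auto
    also have "\<dots> \<le> max_modulus (\<mu> * r) f + cmod (f 0) + \<mu> * r * (\<mu> * a + a)"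
      using f1(2)[OF r\<mu>(2)] by (simp add: distrib_left)
    finally have 2: "\<mu>\<^sup>2 * max_modulus r f \<le> max_modulus (\<mu> * r) f + (\<mu>\<^sup>2 * cmod (f 0) + cmod (f 0) + \<mu> * r * (\<mu> * a + a))"
      by (simp add: right_diff_distrib)
    have \<mu>2: "1 \<le> \<mu>\<^sup>2" "\<mu> \<le> \<mu>\<^sup>2" using one_le_power[OF \<mu>, of 2] self_le_power[OF \<mu>, of 2] by simp_all
    have ar: "a \<le> a * r" using a0 r by (simp add: mult_le_cancel_left1)
    have "\<mu>\<^sup>2 * cmod (f 0) \<le> \<mu>\<^sup>2 * (a * r)"
      using a ar by (intro mult_left_mono) auto
    moreover have "cmod (f 0) \<le> \<mu>\<^sup>2 * (a * r)"
      using mult_mono[OF \<mu>2(1) order_trans[OF a(1) ar]] by simp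
    moreover have "\<mu> * r * (\<mu> * a + a) \<le> 2 * (\<mu>\<^sup>2 * (a * r))"
    proof -
      have "\<mu> * (a * r) \<le> \<mu>\<^sup>2 * (a * r)" using \<mu>2 a0 r by (intro mult_right_mono) auto
      then show ?thesis by (simp add: algebra_simps power2_eq_square)
    qed
    ultimately have "\<mu>\<^sup>2 * cmod (f 0) + cmod (f 0) + \<mu> * r * (\<mu> * a + a) \<le> 4 * (\<mu>\<^sup>2 * (a * r))" by linarith
    with 2 show "\<mu>\<^sup>2 * max_modulus r f - 4 * \<mu>\<^sup>2 * a * r \<le> max_modulus (\<mu> * r) f"
      by (simp add: mult.assoc)
  qed
qed

text \<open>
Since \<open>M(r, f)\<close> grows faster than linearly, half of the quadratic gain \<open>\<mu>\<^sup>2\<close> survives the error term, and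
half of \<open>\<mu>\<^sup>2\<close> is \<open>2 A \<mu>\<close>.
\<close>

lemma max_modulus_dilation_ge:
  assumes f: "transcendental_entire f" and A: "1 \<le> A" and \<mu>: "\<mu> = 4 * A"
  shows "eventually (\<lambda>r. 2 * A * \<mu> * max_modulus r f \<le> max_modulus (\<mu> * r) f) at_top"
proof -
  note hol = transcendental_entire_holomorphic[OF f]
  obtain a where a: "0 \<le> a"
    "\<And>\<mu> r. 1 \<le> \<mu> \<Longrightarrow> 1 \<le> r \<Longrightarrow> \<mu>\<^sup>2 * max_modulus r f - 4 * \<mu>\<^sup>2 * a * r \<le> max_modulus (\<mu> * r) f"
    using max_modulus_dilation[OF hol] by blast
  show ?thesis
    using max_modulus_superpolynomial[OF f, of "8 * a" 1] eventually_ge_at_top[of 1]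
  proof eventually_elim
    case (elim r)
    have "\<mu>\<^sup>2 * (8 * a * r) \<le> \<mu>\<^sup>2 * max_modulus r f" using elim by (intro mult_left_mono) auto
    moreover have "\<mu>\<^sup>2 * max_modulus r f - 4 * \<mu>\<^sup>2 * a * r \<le> max_modulus (\<mu> * r) f"
      using \<mu> A elim by (intro a) auto
    ultimately have "\<mu>\<^sup>2 * max_modulus r f \<le> 2 * max_modulus (\<mu> * r) f" by simp
    then show ?case using \<mu> by (simp add: power2_eq_square)
  qed
qed

section \<open>Circles in images of discs\<close>

text \<open>
A version of Bohr's theorem on circles in the image of a disc. If the image misses a point \<open>a\<close> of the circle of radius \<open>t\<close> and
a point \<open>b\<close> of the circle of radius \<open>2 t\<close>, then \<open>(f - a)/(b - a)\<close> omits 0 and 1 and is bounded by 2 at the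
centre. Schottky's theorem then bounds \<open>f\<close> on the disc of half the radius by a constant times \<open>t\<close>.
\<close>

lemma image_cball_contains_circle:
  obtains C where "1 \<le> C"
    "\<And>f r t. \<lbrakk>f holomorphic_on UNIV; 0 < r; 0 < t; cmod (f 0) \<le> t; C * t < max_modulus (r / 2) f\<rbrakk>
       \<Longrightarrow> sphere 0 t \<subseteq> f ` cball 0 r \<or> sphere 0 (2 * t) \<subseteq> f ` cball 0 r"
proof
  define C where "C = exp (pi * exp (pi * (2 + 2 * 2 + 12 * (1 / 2) / (1 - 1 / 2 :: real))))"
  have "C > 0" by (simp add: C_def)
  then show "1 \<le> 1 + 3 * C" by simp
  fix f :: "complex \<Rightarrow> complex" and r t :: real
  assume f: "f holomorphic_on UNIV" and r: "0 < r" and t: "0 < t" and f0: "cmod (f 0) \<le> t"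
    and M: "(1 + 3 * C) * t < max_modulus (r / 2) f"
  show "sphere 0 t \<subseteq> f ` cball 0 r \<or> sphere 0 (2 * t) \<subseteq> f ` cball 0 r"
  proof (rule ccontr)
    assume "\<not> ?thesis"
    then obtain a b where "a \<in> sphere 0 t - f ` cball 0 r" "b \<in> sphere 0 (2 * t) - f ` cball 0 r"
      by blast
    then have a: "cmod a = t" "a \<notin> f ` cball 0 r" and b: "cmod b = 2 * t" "b \<notin> f ` cball 0 r"
      by auto
    have ab: "t \<le> cmod (b - a)" "cmod (b - a) \<le> 3 * t"
      using norm_triangle_ineq2[of b a] norm_triangle_ineq4[of b a] a b by auto
    then have ne: "b - a \<noteq> 0" using t by auto
    define F where "F = (\<lambda>z. (f (of_real r * z) - a) / (b - a))"
    have hF: "F holomorphic_on cball 0 1"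
      unfolding F_def using ne
      by (intro holomorphic_intros holomorphic_on_compose_gen[OF _ f, unfolded o_def]) auto
    have "cmod (f 0 - a) \<le> 2 * t" using norm_triangle_ineq4[of "f 0" a] f0 a by simp
    also have "\<dots> \<le> 2 * cmod (b - a)" using ab by simp
    finally have F0: "cmod (F 0) \<le> 2" using ne by (simp add: F_def norm_divide divide_le_eq)
    have omit: "\<not> (F z = 0 \<or> F z = 1)" if "z \<in> cball 0 1" for z
    proof -
      have "of_real r * z \<in> cball 0 r" using that r by (simp add: norm_mult mult_left_le)
      then have "f (of_real r * z) \<noteq> a" "f (of_real r * z) \<noteq> b" using a b by blast+
      then show ?thesis using ne by (simp add: F_def)
    qed
    obtain z where z: "cmod z = r / 2" "cmod (f z) = max_modulus (r / 2) f"
      using max_modulus_attained[OF entire_continuous[OF f], of "r / 2"] r by auto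
    have "cmod (F (z / of_real r)) \<le> C"
      unfolding C_def by (rule Schottky[OF hF F0 omit]) (use z r in \<open>auto simp: norm_divide\<close>)
    then have "cmod (f z - a) \<le> C * cmod (b - a)" using r ne by (simp add: F_def norm_divide divide_le_eq)
    also have "\<dots> \<le> C * (3 * t)" using ab \<open>C > 0\<close> by (intro mult_left_mono) auto
    finally have "cmod (f z) \<le> (1 + 3 * C) * t"
      using norm_triangle_ineq2[of "f z" a] a by (simp add: algebra_simps)
    with M z show False by simp
  qed
qed

section \<open>The maximum modulus of iterates\<close>

lemma holomorphic_funpow:
  "f holomorphic_on UNIV \<Longrightarrow> (f ^^ n) holomorphic_on UNIV"
proof (induction n)
  case (Suc n)
  then show ?case using holomorphic_on_compose_gen[of "f ^^ n" UNIV f UNIV] by (simp add: o_def)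
qed (simp add: id_def)

lemma max_modulus_iter_0 [simp]: "max_modulus_iter 0 r f = r"
  by (simp add: max_modulus_iter_def)

lemma max_modulus_iter_Suc:
  "max_modulus_iter (Suc n) r f = max_modulus_iter n (max_modulus r f) f"
  unfolding max_modulus_iter_def by (simp only: funpow_Suc_right o_apply)

lemma max_modulus_iter_Suc':
  "max_modulus_iter (Suc n) r f = max_modulus (max_modulus_iter n r f) f"
  by (simp add: max_modulus_iter_def)

lemma max_modulus_iter_mono:
  assumes f: "f holomorphic_on UNIV" and "0 \<le> r" "r \<le> s"
  shows "max_modulus_iter n r f \<le> max_modulus_iter n s f"
  using assms(2,3)
proof (induction n arbitrary: r s)
  case (Suc n)
  then show ?case unfolding max_modulus_iter_Suc
    by (intro Suc.IH max_modulus_mono max_modulus_nonneg f) auto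
qed simp

lemma max_modulus_iter_pos:
  assumes f: "transcendental_entire f" and "0 < r"
  shows "0 < max_modulus_iter n r f"
  using assms(2)
proof (induction n arbitrary: r)
  case (Suc n)
  note hol = transcendental_entire_holomorphic[OF f]
  have "max_modulus r f \<noteq> 0"
  proof
    assume 0: "max_modulus r f = 0"
    have "(deriv ^^ p) f 0 = 0" for p
      using Cauchy_inequality[of f 0 r 0 p] Suc.prems hol max_modulus_ge_cball[OF hol, of _ r] 0
      by (auto intro: holomorphic_on_subset continuous_on_subset entire_continuous)
    then show False using transcendental_entire_coefficients[OF f] by blast
  qed
  then show ?case unfolding max_modulus_iter_Suc
    using max_modulus_nonneg[OF hol, of r] Suc.prems by (intro Suc.IH) auto
qed simp

lemma max_modulus_funpow_le_iter:
  assumes f: "f holomorphic_on UNIV" and "0 \<le> r"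
  shows "max_modulus r (f ^^ n) \<le> max_modulus_iter n r f"
proof -
  have *: "cmod ((f ^^ n) z) \<le> max_modulus_iter n r f" if "cmod z \<le> r" for z r
    using that
  proof (induction n arbitrary: z r)
    case (Suc n)
    then show ?case unfolding max_modulus_iter_Suc funpow_Suc_right o_apply
      by (intro Suc.IH max_modulus_ge_cball f)
  qed simp
  obtain z where "cmod z = r" "cmod ((f ^^ n) z) = max_modulus r (f ^^ n)"
    using max_modulus_attained[OF entire_continuous[OF holomorphic_funpow[OF f]] \<open>0 \<le> r\<close>] .
  with *[of z r] show ?thesis by simp
qed

text \<open>
Induction on \<open>n\<close>, writing \<open>f\<^bsup>n+1\<^esup>\<close> as \<open>f\<^sup>n\<close> after \<open>f\<close>: the image of the disc of radius \<open>K r\<close> under \<open>f\<close> contains a circle of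
radius at least a fixed multiple of \<open>M(K r/2, f)\<close>, and by the growth under dilations this is at least
\<open>K M(r, f)\<close>. So the factor \<open>K\<close> is recovered in each step and does not accumulate.
\<close>

lemma max_modulus_iter_le_funpow:
  assumes f: "transcendental_entire f"
  obtains K where "1 < K"
    "eventually (\<lambda>r. \<forall>n. max_modulus_iter n r f \<le> max_modulus (K * r) (f ^^ n)) at_top"
proof -
  note hol = transcendental_entire_holomorphic[OF f]
  obtain C where C: "1 \<le> C"
    "\<And>f r t. \<lbrakk>f holomorphic_on UNIV; 0 < r; 0 < t; cmod (f 0) \<le> t; C * t < max_modulus (r / 2) f\<rbrakk>
       \<Longrightarrow> sphere 0 t \<subseteq> f ` cball 0 r \<or> sphere 0 (2 * t) \<subseteq> f ` cball 0 r"
    using image_cball_contains_circle by blast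
  \<comment> \<open>\<open>K\<close> has to satisfy \<open>M(K r/2) \<ge> 2 C K M(r)\<close>; this is the dilation estimate with \<open>A = 2 C\<close> and \<open>\<mu> = K/2\<close>.\<close>
  define \<mu> where "\<mu> = 4 * (2 * C)"
  define K where "K = 2 * \<mu>"
  have K: "1 < K" using C(1) by (simp add: K_def \<mu>_def)
  have "eventually (\<lambda>r. 2 * (2 * C) * \<mu> * max_modulus r f \<le> max_modulus (\<mu> * r) f
      \<and> 1 * r ^ 1 \<le> max_modulus r f \<and> cmod (f 0) * r ^ 0 \<le> max_modulus r f \<and> 1 \<le> r) at_top"
    by (intro eventually_conj max_modulus_dilation_ge f max_modulus_superpolynomial eventually_ge_at_top)
       (use C(1) in \<open>auto simp: \<mu>_def\<close>)
  then obtain r0 where r0: "\<And>r. r \<ge> r0 \<Longrightarrow> 2 * (2 * C) * \<mu> * max_modulus r f \<le> max_modulus (\<mu> * r) f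
      \<and> r \<le> max_modulus r f \<and> cmod (f 0) \<le> max_modulus r f \<and> 1 \<le> r"
    unfolding eventually_at_top_linorder by auto
  have main: "max_modulus_iter n r f \<le> max_modulus (K * r) (f ^^ n)" if "r \<ge> r0" for n r
    using that
  proof (induction n arbitrary: r)
    case 0
    then have "1 \<le> r" using r0 by blast
    then have "r \<le> K * r" "0 \<le> K * r" using K by auto
    moreover have "cmod ((f ^^ 0) (of_real (K * r))) \<le> max_modulus (K * r) (f ^^ 0)"
      using \<open>0 \<le> K * r\<close> by (intro max_modulus_ge_cball holomorphic_funpow hol) (simp only: norm_of_real)
    moreover have "cmod ((f ^^ 0) (of_real (K * r))) = K * r"
      using \<open>0 \<le> K * r\<close> by (simp only: funpow_0 norm_of_real abs_of_nonneg)
    ultimately show ?case unfolding max_modulus_iter_0 by linarith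
  next
    case (Suc n)
    define m where "m = max_modulus r f"
    have m: "2 * (2 * C) * \<mu> * m \<le> max_modulus (\<mu> * r) f" "r \<le> m" "cmod (f 0) \<le> m" "1 \<le> r"
      using r0[OF Suc.prems] by (auto simp: m_def)
    define t where "t = K * m"
    have t: "0 < t" "m \<le> t" using m K by (auto simp: t_def)
    have "sphere 0 t \<subseteq> f ` cball 0 (K * r) \<or> sphere 0 (2 * t) \<subseteq> f ` cball 0 (K * r)"
    proof (rule C(2)[OF hol])
      have "C * t < 2 * C * t" using C(1) t by simp
      also have "\<dots> = 2 * (2 * C) * \<mu> * m" by (simp add: t_def K_def)
      also have "\<dots> \<le> max_modulus (K * r / 2) f" using m by (simp add: K_def)
      finally show "C * t < max_modulus (K * r / 2) f" .
      show "0 < K * r" using m(4) K by simp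
      show "cmod (f 0) \<le> t" using m(3) t(2) by linarith
    qed (rule t(1))
    then obtain s where "s = t \<or> s = 2 * t" and sub: "sphere 0 s \<subseteq> f ` cball 0 (K * r)" by blast
    then have s: "t \<le> s" using t(1) by auto
    obtain w where w: "cmod w = s" "cmod ((f ^^ n) w) = max_modulus s (f ^^ n)"
      using max_modulus_attained[OF entire_continuous[OF holomorphic_funpow[OF hol, of n]], of s] s t(1) by force
    then have "w \<in> f ` cball 0 (K * r)" using sub by (simp add: subset_iff)
    then obtain z where z: "w = f z" "cmod z \<le> K * r" by auto
    have "max_modulus_iter (Suc n) r f = max_modulus_iter n m f" by (simp add: max_modulus_iter_Suc m_def)
    also have "\<dots> \<le> max_modulus (K * m) (f ^^ n)" using m Suc.prems by (intro Suc.IH) auto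
    also have "\<dots> \<le> max_modulus s (f ^^ n)"
      using s t by (intro max_modulus_mono holomorphic_funpow hol) (auto simp: t_def)
    also have "\<dots> = cmod ((f ^^ Suc n) z)" using w z by (simp add: funpow_swap1)
    also have "\<dots> \<le> max_modulus (K * r) (f ^^ Suc n)"
      using z by (intro max_modulus_ge_cball holomorphic_funpow hol)
    finally show ?case .
  qed
  show ?thesis
  proof (rule that[OF K])
    show "eventually (\<lambda>r. \<forall>n. max_modulus_iter n r f \<le> max_modulus (K * r) (f ^^ n)) at_top"
      using eventually_ge_at_top[of r0] by eventually_elim (use main in blast)
  qed
qed

lemma max_modulus_iter_tendsto:
  assumes f: "transcendental_entire f"
  shows "eventually (\<lambda>r. filterlim (\<lambda>n. max_modulus_iter n r f) at_top sequentially) at_top"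
proof -
  have "eventually (\<lambda>r. 2 * r ^ 1 \<le> max_modulus r f) at_top" by (rule max_modulus_superpolynomial[OF f])
  then obtain r0 where r0: "\<And>r. r \<ge> r0 \<Longrightarrow> 2 * r \<le> max_modulus r f"
    unfolding eventually_at_top_linorder by auto
  show ?thesis
    using eventually_ge_at_top[of "max 1 r0"]
  proof eventually_elim
    case (elim r)
    have *: "2 ^ n * r \<le> max_modulus_iter n r f \<and> max 1 r0 \<le> max_modulus_iter n r f" for n
    proof (induction n)
      case (Suc n)
      then have "2 * max_modulus_iter n r f \<le> max_modulus_iter (Suc n) r f"
        unfolding max_modulus_iter_Suc' by (intro r0) auto
      with Suc show ?case by auto
    qed (use elim in auto)
    have "real n \<le> max_modulus_iter n r f" for n
    proof -
      have "real n \<le> 2 ^ n * 1" using of_nat_less_two_power[of n] by (simp add: less_imp_le)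
      also have "\<dots> \<le> 2 ^ n * r" using elim by (intro mult_left_mono) auto
      finally show ?thesis using *[of n] by linarith
    qed
    then show ?case
      by (intro filterlim_at_top_mono[OF filterlim_real_sequentially] always_eventually) blast
  qed
qed

section \<open>Normality and the Julia set\<close>

lemma norm_to_sphere: "norm (to_sphere z) = 1"
proof -
  define p where "p = (cmod z)\<^sup>2"
  have p: "p \<ge> 0" by (simp add: p_def)
  have "(norm (to_sphere z))\<^sup>2 = (2 / (1 + p) * cmod z)\<^sup>2 + ((p - 1) / (p + 1))\<^sup>2"
    using p unfolding to_sphere_def p_def[symmetric] norm_Pair norm_mult norm_of_real
    by (simp add: power_divide)
  also have "\<dots> = (4 * p + (p - 1)\<^sup>2) / (p + 1)\<^sup>2"
    by (simp add: power_mult_distrib power_divide p_def[symmetric] add.commute add_divide_distrib)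
  also have "4 * p + (p - 1)\<^sup>2 = (p + 1)\<^sup>2" by (simp add: power2_eq_square algebra_simps)
  also have "(p + 1)\<^sup>2 / (p + 1)\<^sup>2 = 1" using p by simp
  finally have "norm (to_sphere z) = 1 \<or> norm (to_sphere z) = - 1" by (simp add: power2_eq_1_iff)
  then show ?thesis using norm_ge_zero[of "to_sphere z"] by linarith
qed

lemma chordal_distance_square:
  "(norm (to_sphere w - to_sphere v))\<^sup>2 * ((1 + (cmod w)\<^sup>2) * (1 + (cmod v)\<^sup>2)) = 4 * (cmod (w - v))\<^sup>2"
proof -
  define a b c d where "a = Re w" and "b = Im w" and "c = Re v" and "d = Im v"
  define p q where "p = 1 + (a\<^sup>2 + b\<^sup>2)" and "q = 1 + (c\<^sup>2 + d\<^sup>2)"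
  have pos: "p > 0" "q > 0" by (auto simp: p_def q_def add_pos_nonneg)
  have pw: "1 + (cmod w)\<^sup>2 = p" "(cmod w)\<^sup>2 + 1 = p" "(cmod w)\<^sup>2 - 1 = p - 2"
    and qv: "1 + (cmod v)\<^sup>2 = q" "(cmod v)\<^sup>2 + 1 = q" "(cmod v)\<^sup>2 - 1 = q - 2"
    by (auto simp: p_def q_def a_def b_def c_def d_def cmod_power2)
  have "(norm (to_sphere w - to_sphere v))\<^sup>2
      = (2 / p * a - 2 / q * c)\<^sup>2 + (2 / p * b - 2 / q * d)\<^sup>2 + ((p - 2) / p - (q - 2) / q)\<^sup>2"
    unfolding to_sphere_def pw qv
    by (simp add: norm_Pair cmod_power2 a_def b_def c_def d_def)
  also have "\<dots> = 4 * ((a * q - c * p)\<^sup>2 + (b * q - d * p)\<^sup>2 + (p - q)\<^sup>2) / (p * q)\<^sup>2"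
  proof -
    have "2 / p * a - 2 / q * c = 2 * (a * q - c * p) / (p * q)"
      "2 / p * b - 2 / q * d = 2 * (b * q - d * p) / (p * q)"
      "(p - 2) / p - (q - 2) / q = 2 * (p - q) / (p * q)"
      using pos by (simp_all add: field_simps)
    then show ?thesis by (simp only: power_divide power_mult_distrib) (simp add: add_divide_distrib)
  qed
  also have "(a * q - c * p)\<^sup>2 + (b * q - d * p)\<^sup>2 + (p - q)\<^sup>2 = p * q * ((a - c)\<^sup>2 + (b - d)\<^sup>2)"
    unfolding p_def q_def by algebra
  also have "(a - c)\<^sup>2 + (b - d)\<^sup>2 = (cmod (w - v))\<^sup>2"
    by (simp add: cmod_power2 a_def b_def c_def d_def)
  finally show ?thesis unfolding pw qv using pos by (simp add: power2_eq_square)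
qed

lemma chordal_distance_le: "norm (to_sphere w - to_sphere v) \<le> 2 * cmod (w - v)"
proof -
  have "1 * 1 \<le> (1 + (cmod w)\<^sup>2) * (1 + (cmod v)\<^sup>2)" by (intro mult_mono) auto
  then have "(norm (to_sphere w - to_sphere v))\<^sup>2 * 1
      \<le> (norm (to_sphere w - to_sphere v))\<^sup>2 * ((1 + (cmod w)\<^sup>2) * (1 + (cmod v)\<^sup>2))"
    by (intro mult_left_mono) auto
  then have "(norm (to_sphere w - to_sphere v))\<^sup>2 \<le> (2 * cmod (w - v))\<^sup>2"
    unfolding chordal_distance_square by (simp add: power_mult_distrib)
  then show ?thesis by (rule power2_le_imp_le) simp
qed

text \<open>
For large \<open>w\<close> and \<open>v\<close> the chordal distance is controlled by the difference of the reciprocal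
coordinates \<open>G\<close> and \<open>H\<close> instead of \<open>w - v\<close>. The quantity
\<open>(1 + |w|\<^sup>2) |G|\<^sup>2 = |G|\<^sup>2 + |a G + c|\<^sup>2\<close> is bounded below, as \<open>G\<close> and \<open>a G + c\<close> cannot be
small simultaneously; \<open>\<kappa>\<close> makes this quantitative.
\<close>

lemma chordal_distance_le_reciprocal:
  assumes G: "w = a + c / G" "v = a + c / H" and nz: "G \<noteq> 0" "H \<noteq> 0"
    and \<kappa>: "0 < \<kappa>" "\<kappa> \<le> cmod c / 2" "cmod a * \<kappa> \<le> cmod c / 2"
  shows "norm (to_sphere w - to_sphere v) \<le> 2 * cmod c * cmod (G - H) / \<kappa>\<^sup>2"
proof -
  have low: "\<kappa>\<^sup>2 \<le> (1 + (cmod (a + c / G))\<^sup>2) * (cmod G)\<^sup>2" if "G \<noteq> 0" for G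
  proof (cases "\<kappa> \<le> cmod G")
    case True
    then have "1 * \<kappa>\<^sup>2 \<le> (1 + (cmod (a + c / G))\<^sup>2) * (cmod G)\<^sup>2"
      using \<kappa> by (intro mult_mono power_mono) auto
    then show ?thesis by simp
  next
    case False
    have "cmod c \<le> cmod (a * G + c) + cmod (a * G)" by (metis add_diff_cancel_left' norm_triangle_ineq4)
    also have "cmod (a * G) \<le> cmod a * \<kappa>" using False by (simp add: norm_mult mult_left_mono)
    finally have "\<kappa> \<le> cmod (a * G + c)" using \<kappa> by linarith
    also have "a * G + c = (a + c / G) * G" using that by (simp add: field_simps)
    finally have "\<kappa>\<^sup>2 \<le> (cmod (a + c / G) * cmod G)\<^sup>2" using \<kappa> by (intro power_mono) (auto simp: norm_mult)
    also have "\<dots> \<le> (1 + (cmod (a + c / G))\<^sup>2) * (cmod G)\<^sup>2" by (simp add: power_mult_distrib distrib_right)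
    finally show ?thesis .
  qed
  have wv: "(w - v) * (G * H) = c * (H - G)" unfolding G using nz by (simp add: field_simps)
  let ?n = "norm (to_sphere w - to_sphere v)"
  have "?n\<^sup>2 * (\<kappa>\<^sup>2 * \<kappa>\<^sup>2) \<le> ?n\<^sup>2 * (((1 + (cmod w)\<^sup>2) * (cmod G)\<^sup>2) * ((1 + (cmod v)\<^sup>2) * (cmod H)\<^sup>2))"
    unfolding G by (intro mult_left_mono mult_mono low nz) auto
  also have "\<dots> = (?n\<^sup>2 * ((1 + (cmod w)\<^sup>2) * (1 + (cmod v)\<^sup>2))) * ((cmod G)\<^sup>2 * (cmod H)\<^sup>2)" by (simp only: mult_ac)
  also have "\<dots> = 4 * (cmod ((w - v) * (G * H)))\<^sup>2"
    unfolding chordal_distance_square by (simp add: norm_mult power_mult_distrib)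
  also have "\<dots> = (2 * cmod c * cmod (G - H))\<^sup>2"
    unfolding wv by (simp add: norm_mult power_mult_distrib norm_minus_commute)
  finally have "(?n * \<kappa>\<^sup>2)\<^sup>2 \<le> (2 * cmod c * cmod (G - H))\<^sup>2"
    by (simp add: power_mult_distrib power2_eq_square[of "\<kappa>\<^sup>2"])
  then have "?n * \<kappa>\<^sup>2 \<le> 2 * cmod c * cmod (G - H)" by (rule power2_le_imp_le) simp
  then show ?thesis using \<kappa> by (simp add: pos_le_divide_eq)
qed

text \<open>
Schottky's theorem bounds \<open>F\<close> on the disc of half the radius, and Cauchy's inequality then bounds its derivative.
\<close>

lemma Schottky_Lipschitz:
  obtains L where "0 < L"
    "\<And>F x \<delta> y. \<lbrakk>0 < \<delta>; F holomorphic_on cball x \<delta>; \<And>z. z \<in> cball x \<delta> \<Longrightarrow> F z \<noteq> 0 \<and> F z \<noteq> 1;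
       cmod (F x) \<le> 1; dist x y < \<delta> / 4\<rbrakk> \<Longrightarrow> cmod (F x - F y) \<le> L / \<delta> * dist x y"
proof
  define C where "C = exp (pi * exp (pi * (2 + 2 * 1 + 12 * (1 / 2) / (1 - 1 / 2 :: real))))"
  show "0 < 4 * C" by (simp add: C_def)
  fix F :: "complex \<Rightarrow> complex" and x y :: complex and \<delta> :: real
  assume \<delta>: "0 < \<delta>" and F: "F holomorphic_on cball x \<delta>" and omit: "\<And>z. z \<in> cball x \<delta> \<Longrightarrow> F z \<noteq> 0 \<and> F z \<noteq> 1"
    and Fx: "cmod (F x) \<le> 1" and xy: "dist x y < \<delta> / 4"
  define E where "E = (\<lambda>z. F (x + of_real \<delta> * z))"
  have in_ball: "x + of_real \<delta> * z \<in> cball x \<delta>" if "cmod z \<le> 1" for z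
    using that \<delta> by (simp add: dist_norm norm_mult mult_left_le)
  have hE: "E holomorphic_on cball 0 1"
    unfolding E_def using in_ball
    by (intro holomorphic_on_compose_gen[OF _ F, unfolded o_def] holomorphic_intros) auto
  have E0: "cmod (E 0) \<le> 1" using Fx by (simp add: E_def)
  have E01: "\<not> (E z = 0 \<or> E z = 1)" if "z \<in> cball 0 1" for z
    using omit[OF in_ball[of z]] that by (auto simp: E_def)
  have bound: "cmod (F w) \<le> C" if "dist x w \<le> \<delta> / 2" for w
  proof -
    have "cmod (E ((w - x) / of_real \<delta>)) \<le> C"
      unfolding C_def
      by (rule Schottky[OF hE E0 E01]) (use that \<delta> in \<open>auto simp: norm_divide dist_norm norm_minus_commute field_simps\<close>)
    then show ?thesis using \<delta> by (simp add: E_def)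
  qed
  have near: "dist x u \<le> \<delta> / 2" if "dist x w < \<delta> / 4" "dist w u \<le> \<delta> / 4" for w u
    using dist_triangle[of x u w] that by linarith
  have sub: "cball w (\<delta> / 4) \<subseteq> cball x \<delta>" if "dist x w < \<delta> / 4" for w
  proof
    fix u assume "u \<in> cball w (\<delta> / 4)"
    then show "u \<in> cball x \<delta>" using near[OF that, of u] \<delta> by simp
  qed
  have deriv: "cmod (deriv F w) \<le> 4 * C / \<delta>" if w: "w \<in> ball x (\<delta> / 4)" for w
  proof -
    have "cmod ((deriv ^^ 1) F w) \<le> fact 1 * C / (\<delta> / 4) ^ 1"
    proof (rule Cauchy_inequality)
      have w\<delta>: "cball w (\<delta> / 4) \<subseteq> cball x \<delta>" using w by (intro sub) simp
      show "F holomorphic_on ball w (\<delta> / 4)"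
        by (rule holomorphic_on_subset[OF F order_trans[OF ball_subset_cball w\<delta>]])
      show "continuous_on (cball w (\<delta> / 4)) F"
        by (rule continuous_on_subset[OF holomorphic_on_imp_continuous_on[OF F] w\<delta>])
      show "cmod (F u) \<le> C" if "cmod (w - u) = \<delta> / 4" for u
        using that w near[of w u] by (intro bound) (simp add: dist_norm)
    qed (use \<delta> in auto)
    then show ?thesis by (simp add: mult.commute)
  qed
  have "cmod (F x - F y) \<le> 4 * C / \<delta> * cmod (x - y)"
  proof (rule field_differentiable_bound[of "ball x (\<delta> / 4)" F "deriv F"])
    fix z assume z: "z \<in> ball x (\<delta> / 4)"
    have "F holomorphic_on ball x \<delta>"
      by (rule holomorphic_on_subset[OF F ball_subset_cball])
    moreover have "z \<in> ball x \<delta>" using z \<delta> by simp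
    ultimately show "(F has_field_derivative deriv F z) (at z within ball x (\<delta> / 4))"
      by (intro holomorphic_derivI[OF _ open_ball])
    show "cmod (deriv F z) \<le> 4 * C / \<delta>" by (rule deriv[OF z])
  qed (use \<delta> xy in simp_all)
  then show "cmod (F x - F y) \<le> 4 * C / \<delta> * dist x y" by (simp add: dist_norm)
qed

text \<open>
Montel's criterion in quantitative form. The function \<open>(g - a)/(b - a)\<close> omits 0 and 1, and so does its
reciprocal; at the point \<open>x\<close> one of the two is bounded by 1, and Schottky's theorem applies to it. The omitted values may depend
on \<open>g\<close>, since compactness keeps them bounded and apart from each other.
\<close>

lemma chordal_Lipschitz_omitting:
  assumes AB: "compact A" "compact B" "A \<inter> B = {}" and \<delta>: "0 < \<delta>"
  obtains L where "0 < L"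
    "\<And>g x y a b. \<lbrakk>g holomorphic_on cball x \<delta>; a \<in> A; b \<in> B; a \<notin> g ` cball x \<delta>; b \<notin> g ` cball x \<delta>;
       dist x y < \<delta> / 4\<rbrakk> \<Longrightarrow> norm (to_sphere (g x) - to_sphere (g y)) \<le> L * dist x y"
proof -
  obtain L where L: "0 < L"
    "\<And>F x \<delta> y. \<lbrakk>0 < \<delta>; F holomorphic_on cball x \<delta>; \<And>z. z \<in> cball x \<delta> \<Longrightarrow> F z \<noteq> 0 \<and> F z \<noteq> 1;
       cmod (F x) \<le> 1; dist x y < \<delta> / 4\<rbrakk> \<Longrightarrow> cmod (F x - F y) \<le> L / \<delta> * dist x y"
    using Schottky_Lipschitz by blast
  have "bounded (A \<union> B)" using AB by (simp add: compact_imp_bounded)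
  then have "\<exists>D>0. \<forall>z\<in>A \<union> B. cmod z \<le> D" by (simp only: bounded_pos)
  then obtain D where D: "0 < D" "\<And>z. z \<in> A \<union> B \<Longrightarrow> cmod z \<le> D"
    by blast
  obtain d where d: "0 < d" "\<And>a b. a \<in> A \<Longrightarrow> b \<in> B \<Longrightarrow> d \<le> dist a b"
    using separate_compact_closed[OF AB(1) compact_imp_closed[OF AB(2)] AB(3)] by blast
  \<comment> \<open>Half of the distance \<open>d\<close> of \<open>A\<close> and \<open>B\<close> is left for \<open>|a G + c|\<close> when \<open>|G| < \<kappa>\<close>.\<close>
  define \<kappa> where "\<kappa> = d / (2 * (1 + D))"
  have \<kappa>: "0 < \<kappa>" "\<kappa> \<le> d / 2" "D * \<kappa> \<le> d / 2"
    using d D by (auto simp: \<kappa>_def field_simps)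
  show ?thesis
  proof
    show "0 < (4 * D + 4 * D / \<kappa>\<^sup>2) * (L / \<delta>)" using D \<kappa> L \<delta> by (intro mult_pos_pos add_pos_pos divide_pos_pos) auto
    fix g x y a b
    assume g: "g holomorphic_on cball x \<delta>" and a: "a \<in> A" "a \<notin> g ` cball x \<delta>" and b: "b \<in> B" "b \<notin> g ` cball x \<delta>"
      and xy: "dist x y < \<delta> / 4"
    define c where "c = b - a"
    have dc: "d \<le> cmod c" using d(2)[OF a(1) b(1)] by (simp add: c_def dist_norm norm_minus_commute)
    then have c0: "c \<noteq> 0" using d by auto
    have cD: "cmod c \<le> 2 * D" using norm_triangle_ineq4[of b a] D(2)[of a] D(2)[of b] a b by (simp add: c_def)
    have ga: "g z \<noteq> a" "g z \<noteq> b" if "z \<in> cball x \<delta>" for z using a b that by auto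
    have x: "x \<in> cball x \<delta>" "y \<in> cball x \<delta>" using xy \<delta> by auto
    have Ld: "0 \<le> L / \<delta> * dist x y" using L \<delta> by simp
    show "norm (to_sphere (g x) - to_sphere (g y)) \<le> (4 * D + 4 * D / \<kappa>\<^sup>2) * (L / \<delta>) * dist x y"
    proof (cases "cmod (g x - a) \<le> cmod c")
      case True
      define F where "F = (\<lambda>z. (g z - a) / c)"
      have "cmod (F x - F y) \<le> L / \<delta> * dist x y"
      proof (rule L(2)[OF \<delta>])
        show "F holomorphic_on cball x \<delta>" unfolding F_def using c0 g by (intro holomorphic_intros) auto
        show "F z \<noteq> 0 \<and> F z \<noteq> 1" if "z \<in> cball x \<delta>" for z
          using ga[OF that] c0 by (simp add: F_def c_def)
        show "cmod (F x) \<le> 1" using True c0 by (simp add: F_def norm_divide)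
      qed (rule xy)
      moreover have "g x - g y = c * (F x - F y)" using c0 by (simp add: F_def field_simps)
      ultimately have "cmod (g x - g y) \<le> 2 * D * (L / \<delta> * dist x y)"
        using mult_mono[OF cD, of "cmod (F x - F y)" "L / \<delta> * dist x y"] D by (simp add: norm_mult)
      with chordal_distance_le[of "g x" "g y"]
      have "norm (to_sphere (g x) - to_sphere (g y)) \<le> 4 * D * (L / \<delta> * dist x y)" by linarith
      also have "\<dots> \<le> (4 * D + 4 * D / \<kappa>\<^sup>2) * (L / \<delta> * dist x y)"
        using D Ld by (intro mult_right_mono) auto
      finally show ?thesis by (simp only: mult.assoc)
    next
      case False
      define G where "G = (\<lambda>z. c / (g z - a))"
      have "cmod (G x - G y) \<le> L / \<delta> * dist x y"
      proof (rule L(2)[OF \<delta>])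
        show "G holomorphic_on cball x \<delta>" unfolding G_def using ga g by (intro holomorphic_intros) auto
        show "G z \<noteq> 0 \<and> G z \<noteq> 1" if "z \<in> cball x \<delta>" for z
          using ga[OF that] c0 by (simp add: G_def c_def)
        show "cmod (G x) \<le> 1" using False ga[OF x(1)] by (simp add: G_def norm_divide)
      qed (rule xy)
      then have "2 * cmod c * cmod (G x - G y) \<le> 2 * (2 * D) * (L / \<delta> * dist x y)"
        using cD D by (intro mult_mono) auto
      then have "2 * cmod c * cmod (G x - G y) / \<kappa>\<^sup>2 \<le> 2 * (2 * D) * (L / \<delta> * dist x y) / \<kappa>\<^sup>2"
        by (rule divide_right_mono) simp
      moreover have "norm (to_sphere (g x) - to_sphere (g y)) \<le> 2 * cmod c * cmod (G x - G y) / \<kappa>\<^sup>2"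
      proof (rule chordal_distance_le_reciprocal)
        show "g x = a + c / G x" "g y = a + c / G y" "G x \<noteq> 0" "G y \<noteq> 0"
          using c0 ga[OF x(1)] ga[OF x(2)] by (auto simp: G_def)
        show "0 < \<kappa>" "\<kappa> \<le> cmod c / 2" using \<kappa> dc by auto
        have "cmod a * \<kappa> \<le> D * \<kappa>" using D(2)[of a] a \<kappa> by (intro mult_right_mono) auto
        then show "cmod a * \<kappa> \<le> cmod c / 2" using \<kappa> dc by linarith
      qed
      ultimately have "norm (to_sphere (g x) - to_sphere (g y)) \<le> 4 * D / \<kappa>\<^sup>2 * (L / \<delta> * dist x y)"
        by (simp add: mult.commute)
      also have "\<dots> \<le> (4 * D + 4 * D / \<kappa>\<^sup>2) * (L / \<delta> * dist x y)"
        using D Ld by (intro mult_right_mono) auto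
      finally show ?thesis by (simp only: mult.assoc)
    qed
  qed
qed

text \<open>
The family is equicontinuous with respect to the chordal metric, so the theorem of Arzela and Ascoli applies on
the closed disc of radius \<open>\<delta>\<close>. The radius \<open>2 \<delta>\<close> in the hypotheses leaves a disc of radius \<open>\<delta>\<close> about each of
its points.
\<close>

lemma normal_family_omitting:
  assumes AB: "compact A" "compact B" "A \<inter> B = {}" and \<delta>: "0 < \<delta>"
    and hol: "\<And>g. g \<in> \<F> \<Longrightarrow> g holomorphic_on cball z0 (2 * \<delta>)"
    and omitA: "\<And>g. g \<in> \<F> \<Longrightarrow> \<not> A \<subseteq> g ` cball z0 (2 * \<delta>)"
    and omitB: "\<And>g. g \<in> \<F> \<Longrightarrow> \<not> B \<subseteq> g ` cball z0 (2 * \<delta>)"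
  shows "normal_family_on (ball z0 \<delta>) \<F>"
  unfolding normal_family_on_def
proof (intro allI impI)
  fix g :: "nat \<Rightarrow> complex \<Rightarrow> complex" assume g: "range g \<subseteq> \<F>"
  obtain L where L: "0 < L"
    "\<And>g x y a b. \<lbrakk>g holomorphic_on cball x \<delta>; a \<in> A; b \<in> B; a \<notin> g ` cball x \<delta>; b \<notin> g ` cball x \<delta>;
       dist x y < \<delta> / 4\<rbrakk> \<Longrightarrow> norm (to_sphere (g x) - to_sphere (g y)) \<le> L * dist x y"
    using chordal_Lipschitz_omitting[OF AB \<delta>] by blast
  have Lip: "norm (to_sphere (g n x) - to_sphere (g n y)) \<le> L * dist x y"
    if x: "x \<in> cball z0 \<delta>" and xy: "dist x y < \<delta> / 4" for n x y
  proof -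
    have gF: "g n \<in> \<F>" using g by auto
    have sub: "cball x \<delta> \<subseteq> cball z0 (2 * \<delta>)"
    proof
      fix u assume "u \<in> cball x \<delta>"
      then show "u \<in> cball z0 (2 * \<delta>)" using x dist_triangle[of z0 u x] by simp
    qed
    obtain a b where "a \<in> A" "a \<notin> g n ` cball z0 (2 * \<delta>)" "b \<in> B" "b \<notin> g n ` cball z0 (2 * \<delta>)"
      using omitA[OF gF] omitB[OF gF] by blast
    with sub show ?thesis
      by (intro L(2)[OF holomorphic_on_subset[OF hol[OF gF]]] xy) blast+
  qed
  obtain h k where hk: "strict_mono (k :: nat \<Rightarrow> nat)"
    "\<And>e. 0 < e \<Longrightarrow> \<exists>N. \<forall>n x. n \<ge> N \<and> x \<in> cball z0 \<delta> \<longrightarrow> norm (to_sphere (g (k n) x) - h x) < e"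
  proof (rule Arzela_Ascoli[of "cball z0 \<delta>" "\<lambda>n x. to_sphere (g n x)" 1])
    show "\<exists>d>0. \<forall>n y. y \<in> cball z0 \<delta> \<and> norm (x - y) < d \<longrightarrow> norm (to_sphere (g n x) - to_sphere (g n y)) < e"
      if x: "x \<in> cball z0 \<delta>" and e: "0 < e" for x e
    proof (intro exI[of _ "min (\<delta> / 4) (e / L)"] conjI allI impI)
      show "0 < min (\<delta> / 4) (e / L)" using \<delta> e L by simp
      fix n y assume "y \<in> cball z0 \<delta> \<and> norm (x - y) < min (\<delta> / 4) (e / L)"
      then have y: "dist x y < \<delta> / 4" "L * dist x y < e"
        using L by (auto simp: dist_norm field_simps)
      then show "norm (to_sphere (g n x) - to_sphere (g n y)) < e"
        using Lip[OF x y(1), of n] by linarith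
    qed
  qed (auto simp: norm_to_sphere)
  show "\<exists>r h. strict_mono r \<and> (\<forall>K. compact K \<and> K \<subseteq> ball z0 \<delta> \<longrightarrow>
           uniform_limit K (\<lambda>k z. to_sphere (g (r k) z)) h sequentially)"
  proof (intro exI conjI allI impI)
    show "strict_mono k" by (rule hk(1))
    fix K assume "compact K \<and> K \<subseteq> ball z0 \<delta>"
    then have K: "K \<subseteq> cball z0 \<delta>" using ball_subset_cball by blast
    show "uniform_limit K (\<lambda>n z. to_sphere (g (k n) z)) h sequentially"
      unfolding uniform_limit_sequentially_iff
    proof (intro allI impI)
      fix e :: real assume "0 < e"
      from hk(2)[OF this] K show "\<exists>N. \<forall>n\<ge>N. \<forall>x\<in>K. dist (to_sphere (g (k n) x)) (h x) < e"
        unfolding dist_norm by blast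
    qed
  qed
qed

text \<open>
Otherwise all iterates would omit, on a fixed disc in \<open>U\<close> about a point of the Julia set, one value from
\<open>A\<close> and one from \<open>B\<close>, and they would form a normal family on a smaller disc.
\<close>

lemma julia_set_blow_up:
  assumes f: "f holomorphic_on UNIV" and U: "open U" "U \<inter> julia_set f \<noteq> {}"
    and AB: "compact A" "compact B" "A \<inter> B = {}"
  obtains m where "A \<subseteq> (f ^^ m) ` U \<or> B \<subseteq> (f ^^ m) ` U"
proof -
  have "\<exists>m. A \<subseteq> (f ^^ m) ` U \<or> B \<subseteq> (f ^^ m) ` U"
  proof (rule ccontr)
    assume none: "\<not> ?thesis"
    obtain z where z: "z \<in> U" "z \<in> julia_set f" using U by blast
    obtain e where e: "0 < e" "cball z e \<subseteq> U" using U z open_contains_cball by blast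
    have "normal_family_on (ball z (e / 2)) (range (\<lambda>n. f ^^ n))"
    proof (rule normal_family_omitting[OF AB])
      fix g assume "g \<in> range (\<lambda>n. f ^^ n)"
      then obtain n where g: "g = f ^^ n" by auto
      show "g holomorphic_on cball z (2 * (e / 2))"
        unfolding g using holomorphic_funpow[OF f] by (rule holomorphic_on_subset) auto
      show "\<not> A \<subseteq> g ` cball z (2 * (e / 2))" "\<not> B \<subseteq> g ` cball z (2 * (e / 2))"
        unfolding g using none image_mono[of "cball z (2 * (e / 2))" U "f ^^ n"] e(2)
        by (simp_all) (meson subset_trans)+
    qed (use e in auto)
    then show False using z(2) e(1) unfolding julia_set_def
      by (auto dest!: spec[of _ "ball z (e / 2)"])
  qed
  then show ?thesis using that by blast
qed

section \<open>Spherical area of iterates\<close>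

text \<open>
By the chain rule, the spherical area form of \<open>g \<circ> f\<close> is the pull-back under \<open>f\<close> of that of \<open>g\<close>, and the area
inequality for images of holomorphic maps applies.
\<close>

lemma spherical_area_compose_ge:
  assumes f: "f holomorphic_on UNIV" and g: "g holomorphic_on UNIV"
    and U: "open U" and W: "W \<in> sets borel" "W \<subseteq> f ` U"
  shows "spherical_area W g \<le> spherical_area U (g \<circ> f)"
proof -
  have chain: "spherical_deriv (g \<circ> f) z = spherical_deriv g (f z) * cmod (deriv f z)" for z
  proof -
    have "deriv (g \<circ> f) z = deriv g (f z) * deriv f z"
      using f g by (intro deriv_chain) (auto simp: holomorphic_on_def)
    then show ?thesis by (simp add: spherical_deriv_def norm_mult)
  qed
  have "(\<integral>\<^sup>+z\<in>W. ennreal ((spherical_deriv g z)\<^sup>2) \<partial>lborel)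
      \<le> (\<integral>\<^sup>+z\<in>U. ennreal ((spherical_deriv g (f z))\<^sup>2 * (cmod (deriv f z))\<^sup>2) \<partial>lborel)"
    using f W U by (intro nn_integral_holomorphic_image_le)
      (auto intro!: borel_measurable_continuous_onI continuous_intros continuous_spherical_deriv g
         intro: holomorphic_on_subset)
  then show ?thesis
    unfolding spherical_area_def chain by (intro mult_left_mono) (simp_all add: power_mult_distrib)
qed

text \<open>
With \<open>x = M\<^sup>n(P, f)\<close> and \<open>Q = K M(P, f)\<close> one has \<open>M(P, f\<^sup>n) \<le> x\<close> and
\<open>M(Q, f\<^sup>n) \<ge> M\<^sup>n(M(P, f), f) = M(x, f)\<close>. The latter exceeds every given power of \<open>x\<close> once \<open>n\<close> is large, whereas
the constants of the annulus estimate depend only on \<open>Q/P\<close>.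
\<close>

lemma spherical_area_annulus_ge_iter:
  assumes f: "transcendental_entire f"
  obtains K where "1 < K"
    "eventually (\<lambda>P. eventually (\<lambda>n. ennreal (ln (max_modulus_iter n P f))
       \<le> spherical_area {z. P / exp 1 < cmod z \<and> cmod z < exp 1 * (K * max_modulus P f)} (f ^^ n)) sequentially) at_top"
proof -
  note hol = transcendental_entire_holomorphic[OF f]
  obtain K where K: "1 < K"
    "eventually (\<lambda>r. \<forall>n. max_modulus_iter n r f \<le> max_modulus (K * r) (f ^^ n)) at_top"
    using max_modulus_iter_le_funpow[OF f] by blast
  then obtain r0 where r0: "\<And>r n. r0 \<le> r \<Longrightarrow> max_modulus_iter n r f \<le> max_modulus (K * r) (f ^^ n)"
    unfolding eventually_at_top_linorder by blast
  have "eventually (\<lambda>P. eventually (\<lambda>n. ennreal (ln (max_modulus_iter n P f))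
       \<le> spherical_area {z. P / exp 1 < cmod z \<and> cmod z < exp 1 * (K * max_modulus P f)} (f ^^ n)) sequentially) at_top"
    using max_modulus_iter_tendsto[OF f] max_modulus_superpolynomial[OF f, of 1 1]
      eventually_ge_at_top[of "max 1 r0"]
  proof eventually_elim
    case (elim P)
    define Q where "Q = K * max_modulus P f"
    have P: "1 \<le> P" "r0 \<le> P" "P \<le> max_modulus P f" using elim by auto
    then have "1 * max_modulus P f < K * max_modulus P f" using K(1) by (intro mult_strict_right_mono) auto
    with P(3) have PQ: "P < Q" by (simp add: Q_def)
    define c where "c = exp (- 2) / 2 / (1 + ln (Q / P))"
    have "0 \<le> ln (Q / P)" using P PQ by simp
    then have c: "c > 0" by (simp add: c_def add_pos_nonneg)
    \<comment> \<open>The power is chosen so that \<open>c log (x\<^sup>N) \<ge> 4 log x\<close>; subtracting \<open>2 log x + log 2\<close> leaves at least \<open>log x\<close>.\<close>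
    obtain N :: nat where N: "4 / c \<le> real N" using real_arch_simple by blast
    have cN: "4 \<le> c * real N" using N c by (simp add: field_simps)
    have "eventually (\<lambda>x. 1 * x ^ N \<le> max_modulus x f \<and> 2 \<le> x) at_top"
      by (intro eventually_conj max_modulus_superpolynomial[OF f] eventually_ge_at_top)
    then have "eventually (\<lambda>n. 1 * max_modulus_iter n P f ^ N \<le> max_modulus (max_modulus_iter n P f) f
         \<and> 2 \<le> max_modulus_iter n P f) sequentially"
      by (rule eventually_compose_filterlim[OF _ elim(1)])
    then show ?case
    proof eventually_elim
      case (elim n)
      define x where "x = max_modulus_iter n P f"
      have x: "2 \<le> x" "x ^ N \<le> max_modulus x f" using elim by (auto simp: x_def)
      have "ln 2 \<le> ln x" "0 \<le> ln x" using x by auto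
      have "ennreal (ln x) \<le> ennreal (exp (- 2) / 2 * ln (x ^ N) / (1 + ln (Q / P)) - 2 * ln x - ln 2)"
      proof (rule ennreal_leI)
        have "4 * ln x \<le> c * real N * ln x" using cN \<open>0 \<le> ln x\<close> by (rule mult_right_mono)
        also have "\<dots> = exp (- 2) / 2 * ln (x ^ N) / (1 + ln (Q / P))"
          using x by (simp add: c_def ln_realpow)
        finally show "ln x \<le> exp (- 2) / 2 * ln (x ^ N) / (1 + ln (Q / P)) - 2 * ln x - ln 2"
          using \<open>ln 2 \<le> ln x\<close> by linarith
      qed
      also have "\<dots> \<le> spherical_area {z. P / exp 1 < cmod z \<and> cmod z < exp 1 * Q} (f ^^ n)"
      proof (rule spherical_area_annulus_ge[OF holomorphic_funpow[OF hol] _ PQ])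
        show "max_modulus P (f ^^ n) \<le> x"
          unfolding x_def using P by (intro max_modulus_funpow_le_iter hol) auto
        have "x ^ N \<le> max_modulus_iter (Suc n) P f" using x by (simp add: x_def max_modulus_iter_Suc')
        also have "\<dots> = max_modulus_iter n (max_modulus P f) f" by (rule max_modulus_iter_Suc)
        also have "\<dots> \<le> max_modulus Q (f ^^ n)" unfolding Q_def using P by (intro r0) auto
        finally show "x ^ N \<le> max_modulus Q (f ^^ n)" .
      qed (use P x in auto)
      finally show ?case by (simp add: x_def Q_def)
    qed
  qed
  with K(1) show ?thesis by (rule that)
qed

theorem theorem1p2:
  fixes f :: "complex \<Rightarrow> complex" and U :: "complex set" and R :: real
  assumes "transcendental_entire f"
    and "open U"
    and "U \<inter> julia_set f \<noteq> {}"
    and "R > 0"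
  shows "\<exists>m :: nat. \<forall>\<^sub>F n in sequentially.
           ereal (ln (max_modulus_iter (n - m) R f)) \<le> enn2ereal (spherical_area U (f ^^ n))"
proof -
  note f = assms(1)
  note hol = transcendental_entire_holomorphic[OF f]
  obtain K where K: "1 < K"
    "eventually (\<lambda>P. eventually (\<lambda>n. ennreal (ln (max_modulus_iter n P f))
       \<le> spherical_area {z. P / exp 1 < cmod z \<and> cmod z < exp 1 * (K * max_modulus P f)} (f ^^ n)) sequentially) at_top"
    using spherical_area_annulus_ge_iter[OF f] by blast
  define ann where "ann = (\<lambda>P. {z. P / exp 1 < cmod z \<and> cmod z < exp 1 * (K * max_modulus P f)})"
  define cann where "cann = (\<lambda>P. {z. P / exp 1 \<le> cmod z \<and> cmod z \<le> exp 1 * (K * max_modulus P f)})"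
  obtain P0 where P0: "\<And>P. P0 \<le> P \<Longrightarrow> eventually (\<lambda>n. ennreal (ln (max_modulus_iter n P f))
       \<le> spherical_area (ann P) (f ^^ n)) sequentially"
    using K(2) unfolding eventually_at_top_linorder ann_def by blast
  define P1 where "P1 = max P0 R"
  \<comment> \<open>The second closed annulus lies outside the first one.\<close>
  define P2 where "P2 = max P1 (exp 1 * (exp 1 * (K * max_modulus P1 f)) + 1)"
  have P: "P0 \<le> P1" "P0 \<le> P2" "R \<le> P1" "R \<le> P2" by (auto simp: P1_def P2_def)
  have "compact (cann P)" for P
  proof -
    have "cann P = cball 0 (exp 1 * (K * max_modulus P f)) - ball 0 (P / exp 1)"
      by (auto simp: cann_def)
    then show ?thesis by (simp add: compact_diff)
  qed
  moreover have "cann P1 \<inter> cann P2 = {}"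
  proof -
    have "exp 1 * (K * max_modulus P1 f) < P2 / exp 1"
      by (simp add: pos_less_divide_eq) (simp add: P2_def less_max_iff_disj mult.commute)
    then show ?thesis by (auto simp: cann_def)
  qed
  ultimately obtain m where "cann P1 \<subseteq> (f ^^ m) ` U \<or> cann P2 \<subseteq> (f ^^ m) ` U"
    using julia_set_blow_up[OF hol assms(2,3), of "cann P1" "cann P2"] by blast
  then obtain P where PR: "R \<le> P" "P0 \<le> P" and "cann P \<subseteq> (f ^^ m) ` U" using P by blast
  moreover have "ann P \<subseteq> cann P" by (auto simp: ann_def cann_def)
  ultimately have sub: "ann P \<subseteq> (f ^^ m) ` U" by blast
  have "open (ann P)" unfolding ann_def
    by (intro open_Collect_conj open_Collect_less continuous_intros)
  then have annb: "ann P \<in> sets borel" by simp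
  have step: "ereal (ln (max_modulus_iter k R f)) \<le> enn2ereal (spherical_area U (f ^^ (k + m)))"
    if "ennreal (ln (max_modulus_iter k P f)) \<le> spherical_area (ann P) (f ^^ k)" for k
  proof -
    have "ln (max_modulus_iter k R f) \<le> ln (max_modulus_iter k P f)"
      using PR assms(4) by (intro ln_mono max_modulus_iter_pos f max_modulus_iter_mono hol) auto
    then have "ennreal (ln (max_modulus_iter k R f)) \<le> ennreal (ln (max_modulus_iter k P f))"
      by (rule ennreal_leI)
    also note that
    also have "spherical_area (ann P) (f ^^ k) \<le> spherical_area U (f ^^ k \<circ> f ^^ m)"
      by (rule spherical_area_compose_ge[OF holomorphic_funpow[OF hol] holomorphic_funpow[OF hol] assms(2) annb sub])
    also have "f ^^ k \<circ> f ^^ m = f ^^ (k + m)" by (simp add: funpow_add)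
    finally have le: "ennreal (ln (max_modulus_iter k R f)) \<le> spherical_area U (f ^^ (k + m))" .
    show ?thesis
    proof (cases "0 \<le> ln (max_modulus_iter k R f)")
      case True
      then show ?thesis using le by (simp add: less_eq_ennreal.rep_eq enn2ereal_ennreal)
    next
      case False
      then have "ereal (ln (max_modulus_iter k R f)) \<le> 0" by simp
      also have "0 \<le> enn2ereal (spherical_area U (f ^^ (k + m)))" by (rule enn2ereal_nonneg)
      finally show ?thesis .
    qed
  qed
  obtain k0 where k0: "\<And>k. k0 \<le> k \<Longrightarrow> ennreal (ln (max_modulus_iter k P f)) \<le> spherical_area (ann P) (f ^^ k)"
    using P0[OF PR(2)] unfolding eventually_sequentially by blast
  show ?thesis
  proof (intro exI[of _ m] eventually_sequentiallyI[of "k0 + m"])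
    fix n assume "k0 + m \<le> n"
    then have "k0 \<le> n - m" "n - m + m = n" by auto
    then show "ereal (ln (max_modulus_iter (n - m) R f)) \<le> enn2ereal (spherical_area U (f ^^ n))"
      using step[OF k0, of "n - m"] by simp
  qed
qed

end
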